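(* Let $n\ge3$, $f\in\mathcal S_r(\mathbb R^{n-1}\times\mathbb R^{n-1})$ and $F=Cf$. Then for all $l\ge0$, all $k$ indexing the spherical harmonics of degree $l$, all $\varrho>0$ and all $\mathbf y\in\mathbb R^{n-1}$, $$(\mathcal F_1f)_{kl}(\varrho,\mathbf y)=\frac{\varrho^{n-1}}{(2\pi)^{n-1}}(\mathcal F F)_{kl}(\varrho,\mathbf y\varrho).$$
   Context: $\mathcal S_r(\mathbb R^{n-1}\times\mathbb R^{n-1})$ is the set of Schwartz functions $f\in\mathcal S(\mathbb R^{2(n-1)})$ with $f(\mathbf x,\mathbf y)=f(\mathbf x,U\mathbf y)$ for all $(\mathbf x,\mathbf y)$ and all orthogonal transformations $U$ of $\mathbb R^{n-1}$. The cone transform is $Cf(\mathbf u,\mathbf v)=\int_{\mathbb R^{n-1}}f(\mathbf u+|\mathbf v|\mathbf y,\mathbf y)\,d\mathbf y$. $\mathcal F_1$ is the $(n-1)$-dimensional Fourier transform in the first $(n-1)$-dimensional variable and $\mathcal F$ the Fourier transform in both variables (convention $\int e^{-ix\cdot\xi}g(x)\,dx$); for $F=Cf$ and $\boldsymbol\xi\ne0$, $\mathcal FF(\boldsymbol\xi,\cdot)$ is the Fourier transform in $\mathbf v$ of $\mathcal F_1F(\boldsymbol\xi,\mathbf v)$. Let $\{Y_{lk}: l\ge0,\ 1\le k\le N(n-1,l)\}$ be an orthonormal basis of $L^2(S^{n-2})$ consisting of spherical harmonics, $Y_{lk}$ of degree $l$, where $N(n-1,l)=\frac{(2l+n-3)(n+l-4)!}{l!\,(n-3)!}$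 for $l\ge1$ and $N(n-1,0)=1$. For a function $g(\boldsymbol\xi,\cdot)$, $g_{kl}(\varrho,\cdot)$ denote its coefficients in $g(\varrho\boldsymbol\varphi,\cdot)=\sum_{l=0}^\infty\sum_{k}g_{kl}(\varrho,\cdot)Y_{lk}(\boldsymbol\varphi)$, $\varrho>0$, $\boldsymbol\varphi\in S^{n-2}$; this is applied to $\mathcal F_1f$, $\mathcal Ff$, $\mathcal F_1F$, $\mathcal FF$. *)

theory Defs
  imports "HOL-Analysis.Analysis"
begin

section \<open>Schwartz functions\<close>

definition dir_deriv :: "'a \<Rightarrow> ('a::real_normed_vector \<Rightarrow> 'b::real_normed_vector) \<Rightarrow> 'a \<Rightarrow> 'b"
  where "dir_deriv b f x = vector_derivative (\<lambda>t. f (x + t *\<^sub>R b)) (at 0)"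

text \<open>A list of basis vectors plays the role of a multi-index. Requiring every iterated partial
  derivative to be (totally) differentiable everywhere amounts to smoothness, and it rules out the
  arbitrary values of \<^const>\<open>vector_derivative\<close> at points of non-differentiability.\<close>

definition schwartz :: "('a::euclidean_space \<Rightarrow> complex) \<Rightarrow> bool"
  where "schwartz f \<longleftrightarrow>
    (\<forall>bs \<in> lists Basis.
       (\<forall>x. foldr dir_deriv bs f differentiable (at x)) \<and>
       (\<forall>j::nat. \<exists>B. \<forall>x. norm x ^ j * norm (foldr dir_deriv bs f x) \<le> B))"

definition schwartz_radial :: "('a::euclidean_space \<times> 'a \<Rightarrow> complex) \<Rightarrow> bool"
  where "schwartz_radial f \<longleftrightarrow>
    schwartz f \<and> (\<forall>U. orthogonal_transformation U \<longrightarrow> (\<forall>x y. f (x, y) = f (x, U y)))"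


section \<open>Fourier transforms and the cone transform\<close>

definition fourier :: "('a::euclidean_space \<Rightarrow> complex) \<Rightarrow> 'a \<Rightarrow> complex"
  where "fourier g \<xi> = (\<integral>x. exp (- (\<i> * of_real (x \<bullet> \<xi>))) * g x \<partial>lborel)"

definition fourier_fst :: "('a::euclidean_space \<times> 'a \<Rightarrow> complex) \<Rightarrow> 'a \<times> 'a \<Rightarrow> complex"
  where "fourier_fst g = (\<lambda>(\<xi>, y). fourier (\<lambda>x. g (x, y)) \<xi>)"

text \<open>The Fourier transform in both variables is taken iteratively, as the cone transform of a
  Schwartz function need not be integrable on the product space.\<close>

definition fourier_both :: "('a::euclidean_space \<times> 'a \<Rightarrow> complex) \<Rightarrow> 'a \<times> 'a \<Rightarrow> complex"
  where "fourier_both g = (\<lambda>(\<xi>, \<eta>). fourier (\<lambda>v. fourier_fst g (\<xi>, v)) \<eta>)"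

definition cone_transform :: "('a::euclidean_space \<times> 'a \<Rightarrow> complex) \<Rightarrow> 'a \<times> 'a \<Rightarrow> complex"
  where "cone_transform f = (\<lambda>(u, v). \<integral>y. f (u + norm v *\<^sub>R y, y) \<partial>lborel)"


section \<open>Spherical harmonics\<close>

text \<open>Surface measure in polar coordinates: the measure of a subset of the unit sphere is the
  dimension times the volume of the cone over it inside the unit ball. The library's
  \<^const>\<open>sgn\<close> is the radial projection \<open>x / |x|\<close>.\<close>

definition sphere_measure :: "'a::euclidean_space measure"
  where "sphere_measure =
    restrict_space
      (distr (density lborel (\<lambda>x. of_nat DIM('a) * indicator (ball 0 1) x)) borel sgn)
      (sphere 0 1)"

definition sphere_L2 :: "('a::euclidean_space \<Rightarrow> complex) \<Rightarrow> bool"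
  where "sphere_L2 g \<longleftrightarrow>
    g \<in> borel_measurable sphere_measure \<and> integrable sphere_measure (\<lambda>\<phi>. (cmod (g \<phi>))\<^sup>2)"

definition sphere_inner ::
    "('a::euclidean_space \<Rightarrow> complex) \<Rightarrow> ('a \<Rightarrow> complex) \<Rightarrow> complex"
  where "sphere_inner g h = (\<integral>\<phi>. g \<phi> * cnj (h \<phi>) \<partial>sphere_measure)"

definition laplacian :: "('a::euclidean_space \<Rightarrow> complex) \<Rightarrow> 'a \<Rightarrow> complex"
  where "laplacian p x = (\<Sum>b\<in>Basis. dir_deriv b (dir_deriv b p) x)"

definition spherical_harmonic :: "nat \<Rightarrow> ('a::euclidean_space \<Rightarrow> complex) \<Rightarrow> bool"
  where "spherical_harmonic l h \<longleftrightarrow>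
    (\<exists>p. polynomial_function p \<and>
         (\<forall>c x. p (c *\<^sub>R x) = of_real (c ^ l) * p x) \<and>
         (\<forall>x. laplacian p x = 0) \<and>
         (\<forall>\<phi>\<in>sphere 0 1. h \<phi> = p \<phi>))"

text \<open>The dimension of the space of spherical harmonics of degree \<open>l\<close> on the unit sphere of
  \<open>\<real>\<^sup>d\<close>, for \<open>d \<ge> 2\<close>; the division is exact.\<close>

definition num_harmonics :: "nat \<Rightarrow> nat \<Rightarrow> nat"
  where "num_harmonics d l =
    (if l = 0 then 1
     else (2 * l + d - 2) * fact (l + d - 3) div (fact l * fact (d - 2)))"

definition harmonic_sum ::
    "(nat \<Rightarrow> nat \<Rightarrow> 'a::euclidean_space \<Rightarrow> complex) \<Rightarrow> (nat \<Rightarrow> nat \<Rightarrow> complex) \<Rightarrow> nat \<Rightarrow> 'a \<Rightarrow> complex"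
  where "harmonic_sum Y c L \<phi> =
    (\<Sum>l\<le>L. \<Sum>k = 1..num_harmonics DIM('a) l. c l k * Y l k \<phi>)"

text \<open>The last conjunct says that the linear span of the family is dense in \<open>L\<^sup>2\<close> of the sphere.\<close>

definition harmonic_basis ::
    "(nat \<Rightarrow> nat \<Rightarrow> 'a::euclidean_space \<Rightarrow> complex) \<Rightarrow> bool"
  where "harmonic_basis Y \<longleftrightarrow>
    (\<forall>l. \<forall>k\<in>{1..num_harmonics DIM('a) l}. spherical_harmonic l (Y l k)) \<and>
    (\<forall>l. \<forall>k\<in>{1..num_harmonics DIM('a) l}. \<forall>l'. \<forall>k'\<in>{1..num_harmonics DIM('a) l'}.
       sphere_inner (Y l k) (Y l' k') = (if l = l' \<and> k = k' then 1 else 0)) \<and>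
    (\<forall>g. sphere_L2 g \<longrightarrow>
       (\<forall>\<epsilon>>0. \<exists>L c. (\<integral>\<phi>. (cmod (g \<phi> - harmonic_sum Y c L \<phi>))\<^sup>2 \<partial>sphere_measure) < \<epsilon>))"

text \<open>The coefficient \<open>g\<^sub>k\<^sub>l(\<rho>, w)\<close> in the expansion of \<open>\<phi> \<mapsto> g(\<rho>\<phi>, w)\<close> in the basis \<open>Y\<close>, with
  arguments in the order \<open>k\<close>, \<open>l\<close>; the lemma \<open>harmonic_expansion_iff\<close> below shows that these are
  exactly the coefficients of the expansion convergent in \<open>L\<^sup>2\<close>.\<close>

definition harmonic_coeff ::
    "(nat \<Rightarrow> nat \<Rightarrow> 'a::euclidean_space \<Rightarrow> complex) \<Rightarrow> ('a \<times> 'a \<Rightarrow> complex) \<Rightarrow>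
     nat \<Rightarrow> nat \<Rightarrow> real \<Rightarrow> 'a \<Rightarrow> complex"
  where "harmonic_coeff Y g k l \<rho> w = sphere_inner (\<lambda>\<phi>. g (\<rho> *\<^sub>R \<phi>, w)) (Y l k)"


section \<open>Coefficients of an expansion in spherical harmonics\<close>

lemma integrable_mult_cnj:
  fixes g h :: "'b \<Rightarrow> complex"
  assumes "g \<in> borel_measurable M" "integrable M (\<lambda>x. (cmod (g x))\<^sup>2)"
    and "h \<in> borel_measurable M" "integrable M (\<lambda>x. (cmod (h x))\<^sup>2)"
  shows "integrable M (\<lambda>x. g x * cnj (h x))"
proof (rule Bochner_Integration.integrable_bound)
  show "integrable M (\<lambda>x. (cmod (g x))\<^sup>2 + (cmod (h x))\<^sup>2)"
    using assms by auto
  have "(\<lambda>x. cnj (h x)) \<in> borel_measurable M"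
    using assms(3) bounded_linear_cnj borel_measurable_continuous_on
      linear_continuous_on by blast
  then show "(\<lambda>x. g x * cnj (h x)) \<in> borel_measurable M"
    using assms(1) by measurable
  have "cmod (g x) * cmod (h x) \<le> (cmod (g x))\<^sup>2 + (cmod (h x))\<^sup>2" for x
    using sum_squares_bound[of "cmod (g x)" "cmod (h x)"]
      mult_nonneg_nonneg[OF norm_ge_zero[of "g x"] norm_ge_zero[of "h x"]] by linarith
  then show "AE x in M. norm (g x * cnj (h x)) \<le> norm ((cmod (g x))\<^sup>2 + (cmod (h x))\<^sup>2)"
    by (auto simp: norm_mult)
qed

lemma norm_diff_orthonormal_sum:
  fixes g :: "'b \<Rightarrow> complex" and e :: "'i \<Rightarrow> 'b \<Rightarrow> complex"
  assumes "finite I"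
    and g: "g \<in> borel_measurable M" "integrable M (\<lambda>x. (cmod (g x))\<^sup>2)"
    and e: "\<And>i. i \<in> I \<Longrightarrow> e i \<in> borel_measurable M"
      "\<And>i. i \<in> I \<Longrightarrow> integrable M (\<lambda>x. (cmod (e i x))\<^sup>2)"
    and on: "\<And>i j. i \<in> I \<Longrightarrow> j \<in> I \<Longrightarrow>
      (\<integral>x. e i x * cnj (e j x) \<partial>M) = (if i = j then 1 else 0)"
  shows "(\<integral>x. (cmod (g x - (\<Sum>i\<in>I. c i * e i x)))\<^sup>2 \<partial>M) =
    (\<integral>x. (cmod (g x))\<^sup>2 \<partial>M) - (\<Sum>i\<in>I. (cmod (\<integral>x. g x * cnj (e i x) \<partial>M))\<^sup>2)
      + (\<Sum>i\<in>I. (cmod ((\<integral>x. g x * cnj (e i x) \<partial>M) - c i))\<^sup>2)"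
proof -
  define a where "a i = (\<integral>x. g x * cnj (e i x) \<partial>M)" for i
  have ige: "integrable M (\<lambda>x. g x * cnj (e i x))" if "i \<in> I" for i
    using g e that by (intro integrable_mult_cnj) auto
  have ieg: "integrable M (\<lambda>x. e i x * cnj (g x))" if "i \<in> I" for i
    using g e that by (intro integrable_mult_cnj) auto
  have iee: "integrable M (\<lambda>x. e i x * cnj (e j x))" if "i \<in> I" "j \<in> I" for i j
    using e that by (intro integrable_mult_cnj) auto
  have igg: "integrable M (\<lambda>x. g x * cnj (g x))"
    using g by (intro integrable_mult_cnj) auto
  have a': "(\<integral>x. e i x * cnj (g x) \<partial>M) = cnj (a i)" for i
    unfolding a_def by (subst Bochner_Integration.integral_cnj[symmetric]) (simp add: mult.commute)
  have sq: "of_real ((cmod z)\<^sup>2) = z * cnj z" for z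
    by (rule complex_norm_square)
  have expand: "of_real ((cmod (g x - (\<Sum>i\<in>I. c i * e i x)))\<^sup>2) =
      g x * cnj (g x) - (\<Sum>i\<in>I. cnj (c i) * (g x * cnj (e i x)))
        - (\<Sum>i\<in>I. c i * (e i x * cnj (g x)))
        + (\<Sum>i\<in>I. \<Sum>j\<in>I. c i * cnj (c j) * (e i x * cnj (e j x)))" for x
    unfolding sq
    by (simp add: algebra_simps sum_distrib_left sum_distrib_right sum_product cnj_sum)
      (rule sum.swap)
  have "complex_of_real (\<integral>x. (cmod (g x - (\<Sum>i\<in>I. c i * e i x)))\<^sup>2 \<partial>M) =
      (\<integral>x. g x * cnj (g x) \<partial>M) - (\<Sum>i\<in>I. cnj (c i) * a i) - (\<Sum>i\<in>I. c i * cnj (a i))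
        + (\<Sum>i\<in>I. \<Sum>j\<in>I. c i * cnj (c j) * (if i = j then 1 else 0))"
    unfolding integral_complex_of_real[symmetric] expand
    using ige ieg iee igg by (simp add: Bochner_Integration.integral_sum a' on flip: a_def)
  also have "\<dots> = (\<integral>x. g x * cnj (g x) \<partial>M) - (\<Sum>i\<in>I. a i * cnj (a i))
        + (\<Sum>i\<in>I. (a i - c i) * cnj (a i - c i))"
    using \<open>finite I\<close> by (simp add: if_distrib algebra_simps sum.distrib sum_subtractf cong: if_cong)
  also have "\<dots> = complex_of_real ((\<integral>x. (cmod (g x))\<^sup>2 \<partial>M) - (\<Sum>i\<in>I. (cmod (a i))\<^sup>2)
        + (\<Sum>i\<in>I. (cmod (a i - c i))\<^sup>2))"
    unfolding of_real_add of_real_diff of_real_sum sq[symmetric]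
    by (simp only: integral_complex_of_real)
  finally show ?thesis
    unfolding a_def of_real_eq_iff .
qed

lemma finite_measure_sphere_measure: "finite_measure (sphere_measure :: 'a::euclidean_space measure)"
proof
  let ?D = "density lborel (\<lambda>x::'a. of_nat DIM('a) * indicator (ball 0 1) x)"
  let ?N = "distr ?D borel sgn"
  have sph: "sphere 0 1 \<in> sets ?N" by simp
  have [measurable]: "(sgn :: 'a \<Rightarrow> 'a) \<in> borel_measurable borel"
    unfolding sgn_div_norm[abs_def] by measurable
  have "emeasure ?N UNIV = emeasure ?D UNIV"
    by (subst emeasure_distr) auto
  also have "\<dots> = of_nat DIM('a) * emeasure lborel (ball (0::'a) 1)"
    by (subst emeasure_density)
      (auto simp: nn_integral_cmult_indicator
        intro!: borel_measurable_times_ennreal borel_measurable_indicator)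
  also have "\<dots> < \<infinity>"
    using emeasure_bounded_finite[of "ball (0::'a) 1"] by (simp add: ennreal_mult_less_top of_nat_less_top)
  finally have "emeasure ?N UNIV < \<infinity>" .
  moreover have "emeasure ?N (sphere 0 1) \<le> emeasure ?N UNIV"
    by (rule emeasure_mono) auto
  ultimately show "emeasure (sphere_measure :: 'a measure) (space sphere_measure) \<noteq> \<infinity>"
    unfolding sphere_measure_def
    by (simp add: space_restrict_space emeasure_restrict_space)
qed

lemma sphere_L2_spherical_harmonic:
  fixes h :: "'a::euclidean_space \<Rightarrow> complex"
  assumes "spherical_harmonic l h"
  shows "sphere_L2 h"
proof -
  obtain p where p: "polynomial_function p" and hp: "\<And>\<phi>. \<phi> \<in> sphere 0 1 \<Longrightarrow> h \<phi> = p \<phi>"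
    using assms unfolding spherical_harmonic_def by blast
  interpret finite_measure "sphere_measure :: 'a measure"
    by (rule finite_measure_sphere_measure)
  have sp: "space (sphere_measure :: 'a measure) = sphere 0 1"
    by (simp add: sphere_measure_def space_restrict_space)
  have "p \<in> borel_measurable borel"
    using p by (intro borel_measurable_continuous_onI continuous_on_polymonial_function)
  then have "p \<in> borel_measurable sphere_measure"
    unfolding sphere_measure_def by (intro measurable_restrict_space1) simp
  then have h: "h \<in> borel_measurable sphere_measure"
    by (subst measurable_cong[where g = p]) (auto simp: sp hp)
  have "compact (p ` sphere 0 1)"
    using p by (intro compact_continuous_image continuous_on_polymonial_function) auto
  then have "bounded (p ` sphere 0 1)" by (rule compact_imp_bounded)
  then obtain B where B: "\<And>\<phi>. \<phi> \<in> sphere 0 1 \<Longrightarrow> cmod (p \<phi>) \<le> B"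
    unfolding bounded_iff by blast
  have "integrable sphere_measure (\<lambda>\<phi>. (cmod (h \<phi>))\<^sup>2)"
    using h by (intro integrable_const_bound[where B = "B\<^sup>2"])
      (auto simp: sp hp intro!: AE_I2 power_mono B)
  with h show ?thesis unfolding sphere_L2_def by simp
qed

lemma harmonic_expansion_iff:
  fixes Y :: "nat \<Rightarrow> nat \<Rightarrow> 'a::euclidean_space \<Rightarrow> complex"
  assumes Y: "harmonic_basis Y" and g: "sphere_L2 g"
  shows "((\<lambda>L. \<integral>\<phi>. (cmod (g \<phi> - harmonic_sum Y c L \<phi>))\<^sup>2 \<partial>sphere_measure) \<longlonglongrightarrow> 0) \<longleftrightarrow>
    (\<forall>l. \<forall>k\<in>{1..num_harmonics DIM('a) l}. c l k = sphere_inner g (Y l k))"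
proof -
  define I where "I L = (SIGMA l:{..L}. {1..num_harmonics DIM('a) l})" for L :: nat
  define a where "a i = sphere_inner g (Y (fst i) (snd i))" for i
  define q where "q h = (\<integral>\<phi>. (cmod (h \<phi>))\<^sup>2 \<partial>(sphere_measure :: 'a measure))" for h
  have fin: "finite (I L)" for L unfolding I_def by auto
  have hs: "harmonic_sum Y d L \<phi> = (\<Sum>i\<in>I L. d (fst i) (snd i) * Y (fst i) (snd i) \<phi>)"
    for d L \<phi>
    unfolding harmonic_sum_def I_def by (subst sum.Sigma) (auto simp: case_prod_beta)
  have YL2: "sphere_L2 (Y (fst i) (snd i))" if "i \<in> I L" for i L
    using that Y sphere_L2_spherical_harmonic unfolding harmonic_basis_def I_def by fastforce
  have key: "q (\<lambda>\<phi>. g \<phi> - harmonic_sum Y d L \<phi>) =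
      q g - (\<Sum>i\<in>I L. (cmod (a i))\<^sup>2) + (\<Sum>i\<in>I L. (cmod (a i - d (fst i) (snd i)))\<^sup>2)" for d L
    unfolding hs a_def q_def sphere_inner_def
  proof (rule norm_diff_orthonormal_sum[OF fin,
        where e = "\<lambda>i. Y (fst i) (snd i)" and c = "\<lambda>i. d (fst i) (snd i)"])
    fix i j assume ij: "i \<in> I L" "j \<in> I L"
    then have "sphere_inner (Y (fst i) (snd i)) (Y (fst j) (snd j)) =
        (if fst i = fst j \<and> snd i = snd j then 1 else 0)"
      using Y unfolding harmonic_basis_def I_def by fastforce
    then show "(\<integral>x. Y (fst i) (snd i) x * cnj (Y (fst j) (snd j) x) \<partial>sphere_measure) =
        (if i = j then 1 else 0)"
      unfolding sphere_inner_def by (simp add: prod_eq_iff)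
  qed (use g YL2 in \<open>auto simp: sphere_L2_def\<close>)
  have q_nonneg: "q h \<ge> 0" for h unfolding q_def by simp
  have bessel: "(\<Sum>i\<in>I L. (cmod (a i))\<^sup>2) \<le> q g" for L
    using key[of "\<lambda>l k. a (l, k)" L]
      q_nonneg[of "\<lambda>\<phi>. g \<phi> - harmonic_sum Y (\<lambda>l k. a (l, k)) L \<phi>"] by simp
  show ?thesis
    unfolding q_def[symmetric]
  proof
    assume lim: "(\<lambda>L. q (\<lambda>\<phi>. g \<phi> - harmonic_sum Y c L \<phi>)) \<longlonglongrightarrow> 0"
    show "\<forall>l. \<forall>k\<in>{1..num_harmonics DIM('a) l}. c l k = sphere_inner g (Y l k)"
    proof (intro allI ballI)
      fix l k assume k: "k \<in> {1..num_harmonics DIM('a) l}"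
      have "(cmod (a (l, k) - c l k))\<^sup>2 \<le> q (\<lambda>\<phi>. g \<phi> - harmonic_sum Y c L \<phi>)" if "l \<le> L" for L
      proof -
        have "(l, k) \<in> I L" using that k unfolding I_def by auto
        then have "(cmod (a (l, k) - c l k))\<^sup>2 \<le>
            (\<Sum>i\<in>I L. (cmod (a i - c (fst i) (snd i)))\<^sup>2)"
          using member_le_sum[of "(l, k)" "I L" "\<lambda>i. (cmod (a i - c (fst i) (snd i)))\<^sup>2"] fin
          by simp
        then show ?thesis using key[of c L] bessel[of L] by linarith
      qed
      then have "(cmod (a (l, k) - c l k))\<^sup>2 \<le> 0"
        by (intro Lim_bounded2[OF lim]) auto
      then show "c l k = sphere_inner g (Y l k)" unfolding a_def by simp
    qed
  next
    assume c: "\<forall>l. \<forall>k\<in>{1..num_harmonics DIM('a) l}. c l k = sphere_inner g (Y l k)"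
    then have "a i = c (fst i) (snd i)" if "i \<in> I L" for i L
      using that unfolding a_def I_def by auto
    then have keyc: "q (\<lambda>\<phi>. g \<phi> - harmonic_sum Y c L \<phi>) = q g - (\<Sum>i\<in>I L. (cmod (a i))\<^sup>2)" for L
      unfolding key by simp
    show "(\<lambda>L. q (\<lambda>\<phi>. g \<phi> - harmonic_sum Y c L \<phi>)) \<longlonglongrightarrow> 0"
    proof (rule LIMSEQ_I)
      fix r :: real assume "r > 0"
      then obtain L0 d where L0: "q (\<lambda>\<phi>. g \<phi> - harmonic_sum Y d L0 \<phi>) < r"
        using Y g unfolding harmonic_basis_def q_def by blast
      have "q (\<lambda>\<phi>. g \<phi> - harmonic_sum Y c L \<phi>) < r" if "L0 \<le> L" for L
      proof -
        have "(\<Sum>i\<in>I L0. (cmod (a i))\<^sup>2) \<le> (\<Sum>i\<in>I L. (cmod (a i))\<^sup>2)"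
          using that fin by (intro sum_mono2) (auto simp: I_def)
        moreover have "(\<Sum>i\<in>I L0. (cmod (a i - d (fst i) (snd i)))\<^sup>2) \<ge> 0"
          by (intro sum_nonneg) auto
        ultimately show ?thesis using keyc[of L] key[of d L0] L0 by linarith
      qed
      then show "\<exists>no. \<forall>n\<ge>no. norm (q (\<lambda>\<phi>. g \<phi> - harmonic_sum Y c n \<phi>) - 0) < r"
        using q_nonneg by (metis abs_of_nonneg diff_zero real_norm_def)
    qed
  qed
qed

end

theory Submission
  imports Defs "HOL-Probability.Sinc_Integral" "HOL-Probability.Characteristic_Functions"
begin

text \<open>The identity already holds pointwise, before taking harmonic coefficients. Fix \<open>\<xi> \<noteq> 0\<close> and let \<open>G\<close>
  be the slice of the partial Fourier transform of \<open>f\<close> at \<open>\<xi>\<close>. By Fubini and translation invariance,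
  the partial Fourier transform of the cone transform at \<open>(\<xi>, v)\<close> is the Fourier transform of \<open>G\<close> at
  \<open>-|v| \<xi>\<close>. As \<open>f\<close> is radial in its second variable, so is \<open>G\<close>, and this point may be replaced by
  \<open>|\<xi>| v\<close>, which has the same norm. Rescaling and inverting the Fourier transform in \<open>v\<close> then
  recovers \<open>G\<close>. The Fourier transform of \<open>G\<close> is integrable because that of \<open>f\<close> decays rapidly.\<close>

section \<open>Integration on Euclidean space\<close>

text \<open>Lebesgue measure is the image of a product of one-dimensional Lebesgue measures, so a
  product of functions of single coordinates integrates factor by factor. This serves the decay
  weight and the Gaussian.\<close>

lemma lborel_prod_component:
  fixes f :: "'a::euclidean_space \<Rightarrow> real \<Rightarrow> 'b::{real_normed_field, banach, second_countable_topology}"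
  assumes f: "\<And>b. b \<in> Basis \<Longrightarrow> integrable lborel (f b)"
  shows integrable_lborel_prod_component: "integrable lborel (\<lambda>x. \<Prod>b\<in>Basis. f b (x \<bullet> b))"
    and integral_lborel_prod_component:
      "(\<integral>x. (\<Prod>b\<in>Basis. f b (x \<bullet> b)) \<partial>lborel) = (\<Prod>b\<in>Basis. integral\<^sup>L lborel (f b))"
proof -
  interpret product_sigma_finite "\<lambda>_::'a. lborel :: real measure" ..
  let ?P = "\<Pi>\<^sub>M b\<in>(Basis :: 'a set). (lborel :: real measure)"
  let ?T = "\<lambda>y. \<Sum>b\<in>Basis. y b *\<^sub>R b :: 'a"
  have T: "?T \<in> measurable ?P borel" by measurable
  have meas: "(\<lambda>x. \<Prod>b\<in>Basis. f b (x \<bullet> b)) \<in> borel_measurable borel"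
  proof (rule borel_measurable_prod)
    fix b :: 'a assume "b \<in> Basis"
    then have [measurable]: "f b \<in> borel_measurable borel"
      using borel_measurable_integrable[OF f] by simp
    show "(\<lambda>x. f b (x \<bullet> b)) \<in> borel_measurable borel" by measurable
  qed
  have eq: "(\<Prod>b\<in>Basis. f b (?T y \<bullet> b)) = (\<Prod>b\<in>Basis. f b (y b))" for y
    by (intro prod.cong) (simp_all add: inner_sum_left_Basis)
  show "integrable lborel (\<lambda>x. \<Prod>b\<in>Basis. f b (x \<bullet> b))"
    by (subst lborel_eq) (simp add: integrable_distr_eq[OF T meas] eq product_integrable_prod f)
  have "(\<integral>x. (\<Prod>b\<in>Basis. f b (x \<bullet> b)) \<partial>lborel) = (\<integral>x. (\<Prod>b\<in>Basis. f b (x \<bullet> b)) \<partial>distr ?P borel ?T)"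
    by (rule arg_cong[where f = "\<lambda>M. integral\<^sup>L M _", OF lborel_eq])
  also have "\<dots> = (\<integral>y. (\<Prod>b\<in>Basis. f b (y b)) \<partial>?P)"
    by (simp add: integral_distr[OF T meas] eq)
  also have "\<dots> = (\<Prod>b\<in>Basis. integral\<^sup>L lborel (f b))"
    by (rule product_integral_prod) (auto intro: f)
  finally show "(\<integral>x. (\<Prod>b\<in>Basis. f b (x \<bullet> b)) \<partial>lborel) = (\<Prod>b\<in>Basis. integral\<^sup>L lborel (f b))" .
qed

section \<open>Translations and dilations of Lebesgue measure\<close>

lemma lborel_affine_substitution:
  fixes g :: "'a::euclidean_space \<Rightarrow> 'b::{banach, second_countable_topology}"
  assumes g[measurable]: "g \<in> borel_measurable borel" and c: "c \<noteq> 0"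
  shows "(\<integral>x. g x \<partial>lborel) = \<bar>c\<bar> ^ DIM('a) *\<^sub>R (\<integral>x. g (t + c *\<^sub>R x) \<partial>lborel)"
  by (subst lborel_affine[OF c, of t])
    (simp add: ennreal_power integral_density integral_distr)

lemma lborel_integral_translate:
  fixes g :: "'a::euclidean_space \<Rightarrow> 'b::{banach, second_countable_topology}"
  assumes [measurable]: "g \<in> borel_measurable borel"
  shows "(\<integral>x. g (t + x) \<partial>lborel) = (\<integral>x. g x \<partial>lborel)"
  using lborel_affine_substitution[of g 1 t] by simp

lemma lborel_integrable_translate:
  fixes g :: "'a::euclidean_space \<Rightarrow> 'b::{banach, second_countable_topology}"
  assumes "integrable lborel g"
  shows "integrable lborel (\<lambda>x. g (t + x))"
proof -
  have "integrable (distr lborel borel ((+) t)) g"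
    unfolding lborel_distr_plus by fact
  then show ?thesis
    by (subst (asm) integrable_distr_eq) (use assms in auto)
qed

lemma nn_integral_lborel_translate:
  fixes g :: "'a::euclidean_space \<Rightarrow> ennreal"
  assumes [measurable]: "g \<in> borel_measurable borel"
  shows "(\<integral>\<^sup>+x. g (t + x) \<partial>lborel) = (\<integral>\<^sup>+x. g x \<partial>lborel)"
  by (subst (2) lborel_distr_plus[of t, symmetric]) (simp add: nn_integral_distr)

text \<open>The proof of uniqueness of Haar measure, comparing with the rotation-invariant unit ball \<open>B\<close>:
  both \<open>|B| \<integral> h(Uy) dy\<close> and \<open>|B| \<integral> h(x) dx\<close> equal the integral of \<open>1\<^sub>B(x - Uy) h(x)\<close> over
  \<open>(x, y)\<close>. The change of variables theorem of the library only covers well-ordered index types.\<close>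

lemma nn_integral_lborel_orthogonal:
  fixes h :: "'a::euclidean_space \<Rightarrow> ennreal" and U :: "'a \<Rightarrow> 'a"
  assumes U: "orthogonal_transformation U" and h[measurable]: "h \<in> borel_measurable borel"
  shows "(\<integral>\<^sup>+y. h (U y) \<partial>lborel) = (\<integral>\<^sup>+x. h x \<partial>lborel)"
proof -
  define V where "V = inv U"
  have lin: "linear U" using U by (rule orthogonal_transformation_linear)
  have UV: "U (V x) = x" for x
    unfolding V_def by (rule surj_f_inv_f[OF orthogonal_transformation_surj[OF U]])
  have V: "orthogonal_transformation V" "linear V"
    unfolding V_def by (rule orthogonal_transformation_inv[OF U]
        orthogonal_transformation_linear[OF orthogonal_transformation_inv[OF U]])+
  have [measurable]: "U \<in> borel_measurable borel" "V \<in> borel_measurable borel"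
    using lin V(2) by (auto intro!: borel_measurable_continuous_onI linear_continuous_on simp: linear_conv_bounded_linear)
  let ?B = "indicator (ball (0::'a) 1) :: 'a \<Rightarrow> ennreal"
  let ?b = "emeasure lborel (ball (0::'a) 1)"
  have [measurable]: "ball (0::'a) 1 \<in> sets borel" by simp
  \<comment> \<open>As \<open>U\<close> is an isometry with inverse \<open>V\<close>, the integrand
    tests whether \<open>y\<close> lies in the unit ball around \<open>V x\<close>, whose volume
    does not depend on \<open>x\<close>.\<close>
  have ball: "(\<integral>\<^sup>+y. ?B (x - U y) \<partial>lborel) = ?b" for x
  proof -
    have "norm (x - U y) = norm (V x - y)" for y
      by (metis UV linear_diff[OF lin] orthogonal_transformation_norm[OF U])
    then have "(\<integral>\<^sup>+y. ?B (x - U y) \<partial>lborel) = (\<integral>\<^sup>+y. indicator (ball (V x) 1) y \<partial>lborel)"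
      by (intro nn_integral_cong) (simp add: indicator_def dist_norm norm_minus_commute[of "U _" x])
    also have "\<dots> = emeasure lborel (ball (V x) 1)" by simp
    also have "\<dots> = ?b" by (simp add: emeasure_ball)
    finally show ?thesis .
  qed
  have "?b * (\<integral>\<^sup>+y. h (U y) \<partial>lborel) = (\<integral>\<^sup>+x. ?B x * (\<integral>\<^sup>+y. h (U y) \<partial>lborel) \<partial>lborel)"
    by (subst nn_integral_multc) (auto intro: borel_measurable_indicator)
  \<comment> \<open>The shift by \<open>x\<close> is absorbed by translation invariance, because
    \<open>x + U y = U (V x + y)\<close>.\<close>
  also have "\<dots> = (\<integral>\<^sup>+x. ?B x * (\<integral>\<^sup>+y. h (x + U y) \<partial>lborel) \<partial>lborel)"
  proof (rule nn_integral_cong, rule arg_cong2[where f = times, OF refl])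
    fix x
    have "(\<integral>\<^sup>+y. h (x + U y) \<partial>lborel) = (\<integral>\<^sup>+y. h (U (V x + y)) \<partial>lborel)"
      by (simp add: linear_add[OF lin] UV)
    also have "\<dots> = (\<integral>\<^sup>+y. h (U y) \<partial>lborel)"
      by (rule nn_integral_lborel_translate) measurable
    finally show "(\<integral>\<^sup>+y. h (U y) \<partial>lborel) = (\<integral>\<^sup>+y. h (x + U y) \<partial>lborel)" ..
  qed
  also have "\<dots> = (\<integral>\<^sup>+x. (\<integral>\<^sup>+y. ?B x * h (x + U y) \<partial>lborel) \<partial>lborel)"
    by (intro nn_integral_cong nn_integral_cmult[symmetric]) auto
  also have "\<dots> = (\<integral>\<^sup>+y. (\<integral>\<^sup>+x. ?B x * h (x + U y) \<partial>lborel) \<partial>lborel)"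
    by (rule lborel_pair.Fubini') measurable
  also have "\<dots> = (\<integral>\<^sup>+y. (\<integral>\<^sup>+x. ?B (x - U y) * h x \<partial>lborel) \<partial>lborel)"
  proof (rule nn_integral_cong)
    fix y
    have "(\<integral>\<^sup>+x. ?B ((U y + x) - U y) * h (U y + x) \<partial>lborel) =
        (\<integral>\<^sup>+x. ?B (x - U y) * h x \<partial>lborel)"
      by (rule nn_integral_lborel_translate) measurable
    then show "(\<integral>\<^sup>+x. ?B x * h (x + U y) \<partial>lborel) = (\<integral>\<^sup>+x. ?B (x - U y) * h x \<partial>lborel)"
      by (simp add: add.commute)
  qed
  also have "\<dots> = (\<integral>\<^sup>+x. (\<integral>\<^sup>+y. ?B (x - U y) * h x \<partial>lborel) \<partial>lborel)"
    by (rule lborel_pair.Fubini') measurable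
  also have "\<dots> = (\<integral>\<^sup>+x. ?b * h x \<partial>lborel)"
  proof (rule nn_integral_cong)
    fix x
    have "(\<integral>\<^sup>+y. ?B (x - U y) * h x \<partial>lborel) = (\<integral>\<^sup>+y. ?B (x - U y) \<partial>lborel) * h x"
      by (rule nn_integral_multc) measurable
    then show "(\<integral>\<^sup>+y. ?B (x - U y) * h x \<partial>lborel) = ?b * h x" by (simp add: ball)
  qed
  also have "\<dots> = ?b * (\<integral>\<^sup>+x. h x \<partial>lborel)"
    by (rule nn_integral_cmult) simp
  finally have *: "?b * (\<integral>\<^sup>+y. h (U y) \<partial>lborel) = ?b * (\<integral>\<^sup>+x. h x \<partial>lborel)" .
  \<comment> \<open>Cancelling a factor in \<open>ennreal\<close> requires it to be neither 0 nor
    infinite.\<close>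
  have "?b \<noteq> 0" "?b \<noteq> top"
    using emeasure_lborel_ball_finite[of "0::'a" 1] less_imp_neq[OF unit_ball_vol_pos, of "real DIM('a)"]
    by (auto simp: emeasure_ball less_top)
  with * show ?thesis by (simp add: ennreal_mult_cancel_left)
qed

lemma lborel_distr_orthogonal:
  fixes U :: "'a::euclidean_space \<Rightarrow> 'a"
  assumes "orthogonal_transformation U"
  shows "distr lborel borel U = lborel"
proof (rule measure_eqI)
  have [measurable]: "U \<in> borel_measurable borel"
    using orthogonal_transformation_linear[OF assms]
    by (auto intro!: borel_measurable_continuous_onI linear_continuous_on simp: linear_conv_bounded_linear)
  fix A assume "A \<in> sets (distr lborel borel U)"
  then have [measurable]: "A \<in> sets borel" by simp
  have "emeasure (distr lborel borel U) A = (\<integral>\<^sup>+y. indicator A (U y) \<partial>lborel)"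
    by (subst nn_integral_indicator[symmetric], simp, subst nn_integral_distr) simp_all
  also have "\<dots> = (\<integral>\<^sup>+x. indicator A x \<partial>lborel)"
    by (rule nn_integral_lborel_orthogonal[OF assms]) simp
  finally show "emeasure (distr lborel borel U) A = emeasure lborel A" by simp
qed simp

section \<open>Rapidly decreasing functions\<close>

text \<open>Decay without smoothness: it suffices for integrability, and it passes to Fourier
  transforms of Schwartz functions, to shears and to slices.\<close>

definition rapidly_decreasing :: "('a::euclidean_space \<Rightarrow> complex) \<Rightarrow> bool"
  where "rapidly_decreasing g \<longleftrightarrow>
    g \<in> borel_measurable borel \<and> (\<forall>j::nat. \<exists>B. \<forall>x. norm x ^ j * norm (g x) \<le> B)"

text \<open>The exponent makes the weight at most the product over the coordinates \<open>t\<close> of \<open>1 / (1 + t\<^sup>2)\<close>.\<close>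

definition decay_weight :: "'a::euclidean_space \<Rightarrow> real"
  where "decay_weight x = inverse ((1 + norm x) ^ (2 * DIM('a)))"

lemma decay_weight_nonneg: "0 \<le> decay_weight x"
  unfolding decay_weight_def by simp

lemma borel_measurable_decay_weight [measurable]: "decay_weight \<in> borel_measurable borel"
  unfolding decay_weight_def[abs_def] by measurable

lemma integrable_decay_weight: "integrable lborel (decay_weight :: 'a::euclidean_space \<Rightarrow> real)"
proof (rule Bochner_Integration.integrable_bound)
  have "integrable lborel (\<lambda>x::real. inverse (1 + x\<^sup>2))"
    using integrable_inverse_1_plus_square by (simp add: set_integrable_def)
  then show "integrable lborel (\<lambda>x::'a. \<Prod>b\<in>Basis. inverse (1 + (x \<bullet> b)\<^sup>2))"
    by (intro integrable_lborel_prod_component)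
  have "decay_weight x \<le> (\<Prod>b\<in>Basis. inverse (1 + (x \<bullet> b)\<^sup>2))" for x :: 'a
  proof -
    have "1 + (x \<bullet> b)\<^sup>2 \<le> (1 + norm x)\<^sup>2" if "b \<in> Basis" for b
    proof -
      have "(x \<bullet> b)\<^sup>2 \<le> (norm x)\<^sup>2"
        using Basis_le_norm[OF that, of x] abs_le_square_iff[of "x \<bullet> b" "norm x"] by simp
      moreover have "(1 + norm x)\<^sup>2 = 1 + 2 * norm x + (norm x)\<^sup>2" by (simp add: power2_sum)
      ultimately show ?thesis using norm_ge_zero[of x] by linarith
    qed
    then have "inverse ((1 + norm x)\<^sup>2) \<le> inverse (1 + (x \<bullet> b)\<^sup>2)" if "b \<in> Basis" for b
      using that by (intro le_imp_inverse_le) (auto intro: add_pos_nonneg)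
    then have "(\<Prod>b\<in>(Basis :: 'a set). inverse ((1 + norm x)\<^sup>2)) \<le> (\<Prod>b\<in>Basis. inverse (1 + (x \<bullet> b)\<^sup>2))"
      by (intro prod_mono) (simp add: power_inverse)
    then show ?thesis by (simp add: decay_weight_def power_mult power_inverse)
  qed
  then show "AE x :: 'a in lborel. norm (decay_weight x) \<le> norm (\<Prod>b\<in>Basis. inverse (1 + (x \<bullet> b)\<^sup>2))"
    by (intro AE_I2) (simp add: decay_weight_nonneg order_trans[OF _ abs_ge_self])
qed simp

text \<open>Serves to dominate difference quotients with steps of length at most 1 by a single
  integrable function. The constant comes from
  \<open>1 + norm x \<le> 2 * (1 + norm (x + t))\<close>.\<close>

lemma decay_weight_translate:
  fixes x t :: "'a::euclidean_space"
  assumes "norm t \<le> 1"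
  shows "decay_weight (x + t) \<le> 2 ^ (2 * DIM('a)) * decay_weight x"
proof -
  have "norm x \<le> norm (x + t) + norm t" by (metis add_diff_cancel norm_triangle_ineq4)
  then have "1 + norm x \<le> 2 * (1 + norm (x + t))" using assms norm_ge_zero[of "x + t"] by argo
  then have "(1 + norm x) ^ (2 * DIM('a)) \<le> 2 ^ (2 * DIM('a)) * (1 + norm (x + t)) ^ (2 * DIM('a))"
    by (metis add_nonneg_nonneg norm_ge_zero power_mono power_mult_distrib zero_le_one)
  moreover have "0 < 1 + norm x" "0 < 1 + norm (x + t)" by (auto intro: add_pos_nonneg)
  ultimately show ?thesis
    unfolding decay_weight_def by (simp add: field_simps)
qed

text \<open>Bounds the sections of a function on the product space, uniformly in \<open>y\<close>,
  by an integrable function of \<open>x\<close> alone.\<close>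

lemma decay_weight_fst:
  fixes x :: "'a::euclidean_space" and y :: "'b::euclidean_space"
  shows "decay_weight (x, y) \<le> decay_weight x"
proof -
  have "(1 + norm x) ^ (2 * DIM('a)) \<le> (1 + norm (x, y)) ^ (2 * DIM('a))"
    using norm_fst_le[of x y] by (intro power_mono) auto
  also have "\<dots> \<le> (1 + norm (x, y)) ^ (2 * DIM('a \<times> 'b))"
    by (intro power_increasing) auto
  finally show ?thesis
    unfolding decay_weight_def by (intro le_imp_inverse_le zero_less_power add_pos_nonneg) auto
qed

text \<open>As \<open>1 + norm x\<close> is at most twice the larger of 1 and \<open>norm x\<close>,
  its \<open>j\<close>-th power is at most \<open>2 ^ j * (1 + norm x ^ j)\<close>, so the bounds
  for the exponents 0 and \<open>j\<close> suffice.\<close>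

lemma rapidly_decreasing_power_bound:
  assumes "rapidly_decreasing g"
  obtains B where "\<And>x. (1 + norm x) ^ j * norm (g x) \<le> B"
proof -
  obtain B0 Bj where B: "\<And>x. norm x ^ 0 * norm (g x) \<le> B0" "\<And>x. norm x ^ j * norm (g x) \<le> Bj"
    using assms unfolding rapidly_decreasing_def by meson
  have "(1 + norm x) ^ j * norm (g x) \<le> 2 ^ j * (B0 + Bj)" for x
  proof -
    have "(1 + norm x) ^ j \<le> (2 * max 1 (norm x)) ^ j" by (intro power_mono) auto
    also have "\<dots> \<le> 2 ^ j * (1 + norm x ^ j)"
      unfolding power_mult_distrib by (intro mult_left_mono) (auto simp: max_def)
    finally have "(1 + norm x) ^ j * norm (g x) \<le> 2 ^ j * (1 + norm x ^ j) * norm (g x)"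
      by (intro mult_right_mono) auto
    also have "\<dots> = 2 ^ j * (norm x ^ 0 * norm (g x) + norm x ^ j * norm (g x))"
      by (simp add: algebra_simps)
    also have "\<dots> \<le> 2 ^ j * (B0 + Bj)" by (intro mult_left_mono add_mono B) auto
    finally show ?thesis .
  qed
  then show ?thesis by (rule that)
qed

lemma rapidly_decreasing_weight_bound:
  assumes "rapidly_decreasing g"
  obtains C where "C \<ge> 0" "\<And>x. norm (g x) \<le> C * decay_weight x"
proof -
  obtain B where B: "\<And>x. (1 + norm x) ^ (2 * DIM('a)) * norm (g x) \<le> B"
    using rapidly_decreasing_power_bound[OF assms] by blast
  have pos: "0 < (1 + norm x) ^ (2 * DIM('a))" for x :: 'a
    by (intro zero_less_power add_pos_nonneg) auto
  show ?thesis
  proof (rule that)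
    show "B \<ge> 0" using order_trans[OF norm_ge_zero, of "g 0" B] B[of 0] by simp
    show "norm (g x) \<le> B * decay_weight x" for x
      using B[of x] pos[of x] unfolding decay_weight_def by (simp add: field_simps)
  qed
qed

lemma rapidly_decreasing_integrable:
  assumes "rapidly_decreasing g"
  shows "integrable lborel g"
proof -
  obtain C where C: "C \<ge> 0" "\<And>x. norm (g x) \<le> C * decay_weight x"
    using rapidly_decreasing_weight_bound[OF assms] by blast
  show ?thesis
  proof (rule Bochner_Integration.integrable_bound)
    show "integrable lborel (\<lambda>x. C * decay_weight x)"
      by (intro integrable_mult_right integrable_decay_weight)
    show "g \<in> borel_measurable lborel"
      using assms by (simp add: rapidly_decreasing_def)
    show "AE x in lborel. norm (g x) \<le> norm (C * decay_weight x)"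
      using C(2) by (intro AE_I2) (metis abs_ge_self order_trans real_norm_def)
  qed
qed

section \<open>Fourier transforms of Schwartz functions\<close>

lemma schwartz_dir_deriv:
  assumes "schwartz g" "b \<in> Basis"
  shows "schwartz (dir_deriv b g)"
  unfolding schwartz_def
proof
  fix bs :: "'a list" assume "bs \<in> lists Basis"
  \<comment> \<open>\<open>foldr\<close> applies the last entry of the list first, so the additional
    derivative is appended at the end.\<close>
  then have "bs @ [b] \<in> lists Basis" using assms(2) by simp
  moreover have "foldr dir_deriv bs (dir_deriv b g) = foldr dir_deriv (bs @ [b]) g" by simp
  ultimately show "(\<forall>x. foldr dir_deriv bs (dir_deriv b g) differentiable (at x)) \<and>
      (\<forall>j. \<exists>B. \<forall>x. norm x ^ j * norm (foldr dir_deriv bs (dir_deriv b g) x) \<le> B)"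
    using assms(1) unfolding schwartz_def by metis
qed

lemma schwartz_differentiable: "schwartz g \<Longrightarrow> g differentiable (at x)"
  unfolding schwartz_def by (drule bspec[where x = "[]"]) auto

lemma schwartz_continuous: "schwartz g \<Longrightarrow> continuous_on UNIV g"
  by (simp add: continuous_at_imp_continuous_on differentiable_imp_continuous_within schwartz_differentiable)

lemma schwartz_rapidly_decreasing:
  assumes "schwartz g"
  shows "rapidly_decreasing g"
proof -
  have "\<forall>j::nat. \<exists>B. \<forall>x. norm x ^ j * norm (foldr dir_deriv [] g x) \<le> B"
    using assms unfolding schwartz_def by blast
  then show ?thesis
    using schwartz_continuous[OF assms]
    by (simp add: rapidly_decreasing_def borel_measurable_continuous_onI)
qed

text \<open>Differentiability makes the value chosen by \<open>vector_derivative\<close> a genuine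
  derivative along the line.\<close>

lemma has_vector_derivative_dir_deriv:
  assumes "g differentiable (at x)"
  shows "((\<lambda>t. g (x + t *\<^sub>R b)) has_vector_derivative dir_deriv b g x) (at 0)"
proof -
  have "(\<lambda>t::real. x + t *\<^sub>R b) differentiable (at 0)"
    by (intro derivative_intros)
  then have "(g \<circ> (\<lambda>t. x + t *\<^sub>R b)) differentiable (at 0)"
    using assms by (intro differentiable_chain_at) auto
  then show ?thesis
    unfolding dir_deriv_def by (simp add: vector_derivative_works o_def)
qed

text \<open>The difference quotients of \<open>h\<close> have integral zero by translation invariance.\<close>

lemma integral_directional_derivative_eq_0:
  fixes h Dh :: "'a::euclidean_space \<Rightarrow> complex"
  assumes h: "integrable lborel h"
    and Dh: "Dh \<in> borel_measurable borel"
    and bound: "\<And>x. norm (Dh x) \<le> C * decay_weight x" "C \<ge> 0"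
    and b: "norm b \<le> 1"
    and deriv: "\<And>x. ((\<lambda>t. h (x + t *\<^sub>R b)) has_vector_derivative Dh x) (at 0)"
  shows "(\<integral>x. Dh x \<partial>lborel) = 0"
proof -
  define K where "K x = C * (2 ^ (2 * DIM('a)) * decay_weight x)" for x :: 'a
  \<comment> \<open>The hypothesis concerns only the parameter 0; moving the base point to
    \<open>x + t *\<^sub>R b\<close> gives every \<open>t\<close>.\<close>
  have deriv_at: "((\<lambda>t. h (x + t *\<^sub>R b)) has_vector_derivative Dh (x + t *\<^sub>R b)) (at t)" for x t
  proof -
    have "((\<lambda>s. s - t) has_vector_derivative 1) (at t)"
      by (auto intro!: derivative_eq_intros)
    moreover have "((\<lambda>s. h ((x + t *\<^sub>R b) + s *\<^sub>R b)) has_vector_derivative Dh (x + t *\<^sub>R b)) (at (t - t))"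
      using deriv by simp
    ultimately have "((\<lambda>s. h ((x + t *\<^sub>R b) + s *\<^sub>R b)) \<circ> (\<lambda>s. s - t) has_vector_derivative
        1 *\<^sub>R Dh (x + t *\<^sub>R b)) (at t)"
      by (rule vector_diff_chain_at)
    then show ?thesis by (simp add: o_def algebra_simps)
  qed
  \<comment> \<open>Mean value inequality on the segment: the derivative is bounded there by the
    weight at shifted points, and shifts of length at most 1 cost only the constant in
    \<open>K\<close>.\<close>
  have quot: "norm (h (x + r *\<^sub>R b) - h x) \<le> K x * r" if "0 < r" "r \<le> 1" for x r
  proof -
    have "norm (h (x + r *\<^sub>R b) - h (x + 0 *\<^sub>R b)) \<le> K x * norm (r - 0)"
    proof (rule differentiable_bound[where S = "{0..r}" and f' = "\<lambda>t s. s *\<^sub>R Dh (x + t *\<^sub>R b)"])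
      fix t assume t: "t \<in> {0..r}"
      show "((\<lambda>t. h (x + t *\<^sub>R b)) has_derivative (\<lambda>s. s *\<^sub>R Dh (x + t *\<^sub>R b))) (at t within {0..r})"
        using deriv_at[of x t] unfolding has_vector_derivative_def by (rule has_derivative_at_withinI)
      have "norm (t *\<^sub>R b) \<le> 1"
        using t that b by (auto simp: mult_le_one)
      then have "C * decay_weight (x + t *\<^sub>R b) \<le> K x"
        unfolding K_def using bound(2) by (intro mult_left_mono decay_weight_translate)
      then have "norm (Dh (x + t *\<^sub>R b)) \<le> K x" using bound(1) order_trans by blast
      then show "onorm (\<lambda>s. s *\<^sub>R Dh (x + t *\<^sub>R b)) \<le> K x"
        by (intro onorm_le) (simp add: mult.commute mult_left_mono)
    qed (use that in auto)
    then show ?thesis using that by simp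
  qed
  \<comment> \<open>Dominated convergence is applied along a sequence of steps
    \<open>1 / (n + 1)\<close>; all of them are at most 1, as \<open>quot\<close> requires.\<close>
  define r where "r n = inverse (real (Suc n))" for n
  have r: "0 < r n" "r n \<le> 1" for n unfolding r_def by (auto simp: inverse_le_1_iff)
  have r0: "filterlim r (at 0) sequentially"
    unfolding filterlim_at using r LIMSEQ_inverse_real_of_nat
    by (auto simp: r_def[abs_def] less_imp_neq[THEN not_sym])
  define s where "s n x = (h (x + r n *\<^sub>R b) - h x) /\<^sub>R r n" for n x
  have hr: "integrable lborel (\<lambda>x. h (x + r n *\<^sub>R b))" for n
    using lborel_integrable_translate[OF h, of "r n *\<^sub>R b"] by (simp add: add.commute)
  have "(\<lambda>n. \<integral>x. s n x \<partial>lborel) \<longlonglongrightarrow> (\<integral>x. Dh x \<partial>lborel)"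
  proof (rule integral_dominated_convergence[where w = K])
    show "Dh \<in> borel_measurable lborel" using Dh by simp
    show "s n \<in> borel_measurable lborel" for n
      unfolding s_def[abs_def]
      using borel_measurable_integrable[OF hr[of n]] borel_measurable_integrable[OF h] by measurable
    show "integrable lborel K"
      unfolding K_def[abs_def] by (intro integrable_mult_right integrable_decay_weight)
    show "AE x in lborel. norm (s n x) \<le> K x" for n
    proof (rule AE_I2)
      fix x
      have "norm (s n x) = norm (h (x + r n *\<^sub>R b) - h x) / r n"
        using r[of n] by (simp add: s_def divide_inverse mult.commute)
      also have "\<dots> \<le> K x" using quot[OF r, of x n] r[of n] by (simp add: pos_divide_le_eq)
      finally show "norm (s n x) \<le> K x" .
    qed
    show "AE x in lborel. (\<lambda>n. s n x) \<longlonglongrightarrow> Dh x"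
    proof (rule AE_I2)
      fix x
      have "((\<lambda>t. (h (x + t *\<^sub>R b) - h x) /\<^sub>R t) \<longlongrightarrow> Dh x) (at 0)"
      proof (rule LIM_zero_cancel, rule tendsto_norm_zero_cancel)
        have "((\<lambda>t. norm (h (x + (0 + t) *\<^sub>R b) - h (x + 0 *\<^sub>R b) - t *\<^sub>R Dh x) / norm t) \<longlongrightarrow> 0) (at 0)"
          using deriv[of x] unfolding has_vector_derivative_def has_derivative_at by simp
        moreover have "\<forall>\<^sub>F t in at 0. norm (h (x + (0 + t) *\<^sub>R b) - h (x + 0 *\<^sub>R b) - t *\<^sub>R Dh x) / norm t =
            norm ((h (x + t *\<^sub>R b) - h x) /\<^sub>R t - Dh x)"
        proof (rule eventually_at_filter[THEN iffD2], rule always_eventually, intro allI impI)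
          fix t :: real assume "t \<noteq> 0"
          then have "(h (x + t *\<^sub>R b) - h x) /\<^sub>R t - Dh x = (h (x + t *\<^sub>R b) - h x - t *\<^sub>R Dh x) /\<^sub>R t"
            by (simp add: scaleR_diff_right)
          then show "norm (h (x + (0 + t) *\<^sub>R b) - h (x + 0 *\<^sub>R b) - t *\<^sub>R Dh x) / norm t =
              norm ((h (x + t *\<^sub>R b) - h x) /\<^sub>R t - Dh x)"
            by (simp add: divide_inverse mult.commute)
        qed
        ultimately show "((\<lambda>t. norm ((h (x + t *\<^sub>R b) - h x) /\<^sub>R t - Dh x)) \<longlongrightarrow> 0) (at 0)"
          by (rule Lim_transform_eventually)
      qed
      then show "(\<lambda>n. s n x) \<longlonglongrightarrow> Dh x"
        unfolding s_def by (rule filterlim_compose[OF _ r0])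
    qed
  qed
  moreover have "(\<integral>x. s n x \<partial>lborel) = 0" for n
  proof -
    have "h \<in> borel_measurable borel" using borel_measurable_integrable[OF h] by simp
    then have "(\<integral>x. h (x + r n *\<^sub>R b) \<partial>lborel) = (\<integral>x. h x \<partial>lborel)"
      using lborel_integral_translate[of h "r n *\<^sub>R b"] by (simp add: add.commute)
    then show ?thesis
      unfolding s_def using hr h by simp
  qed
  ultimately show ?thesis by (simp add: LIMSEQ_const_iff)
qed

section \<open>First properties of the Fourier integral\<close>

lemma norm_fourier_kernel [simp]: "cmod (exp (- (\<i> * complex_of_real t))) = 1"
  by (simp add: norm_exp_eq_Re)

lemma borel_measurable_fourier_kernel [measurable]:
  "f \<in> borel_measurable M \<Longrightarrow> (\<lambda>x. exp (- (\<i> * complex_of_real (f x)))) \<in> borel_measurable M"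
  by (rule borel_measurable_continuous_on[where f = "\<lambda>t. exp (- (\<i> * complex_of_real t))"])
    (intro continuous_intros)

lemma integrable_fourier_integrand:
  fixes g :: "'a::euclidean_space \<Rightarrow> complex"
  assumes "integrable lborel g"
  shows "integrable lborel (\<lambda>x. exp (- (\<i> * of_real (x \<bullet> \<xi>))) * g x)"
proof (rule Bochner_Integration.integrable_bound[OF assms])
  have [measurable]: "g \<in> borel_measurable borel" using borel_measurable_integrable[OF assms] by simp
  show "(\<lambda>x. exp (- (\<i> * of_real (x \<bullet> \<xi>))) * g x) \<in> borel_measurable lborel" by measurable
qed (simp add: norm_mult)

lemma norm_fourier_le: "cmod (fourier g \<xi>) \<le> (\<integral>x. cmod (g x) \<partial>lborel)"
  unfolding fourier_def
  by (rule order_trans[OF integral_norm_bound]) (simp add: norm_mult)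

text \<open>Dominated convergence: the integrand is continuous in the frequency and has modulus
  \<open>cmod (g x)\<close>.\<close>

lemma continuous_on_fourier:
  assumes "integrable lborel g"
  shows "continuous_on UNIV (fourier g)"
  unfolding continuous_on_sequentially
proof (intro ballI allI impI)
  fix X :: "nat \<Rightarrow> 'a" and a
  assume X: "(\<forall>n. X n \<in> UNIV) \<and> X \<longlonglongrightarrow> a"
  have [measurable]: "g \<in> borel_measurable borel" using borel_measurable_integrable[OF assms] by simp
  show "(fourier g \<circ> X) \<longlonglongrightarrow> fourier g a"
    unfolding o_def fourier_def
  proof (rule integral_dominated_convergence[where w = "\<lambda>x. cmod (g x)"])
    show "AE x in lborel. (\<lambda>n. exp (- (\<i> * of_real (x \<bullet> X n))) * g x) \<longlonglongrightarrow>
        exp (- (\<i> * of_real (x \<bullet> a))) * g x"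
      using X by (intro AE_I2 tendsto_intros) auto
  qed (use assms in \<open>auto simp: norm_mult\<close>)
qed

text \<open>Integration by parts: \<open>D\<close> is the derivative along \<open>b\<close> of the
  kernel times \<open>g\<close>, and its integral vanishes.\<close>

lemma fourier_dir_deriv:
  assumes g: "schwartz g" and b: "b \<in> Basis"
  shows "fourier (dir_deriv b g) \<xi> = \<i> * of_real (b \<bullet> \<xi>) * fourier g \<xi>"
proof -
  define e where "e x = exp (- (\<i> * complex_of_real (x \<bullet> \<xi>)))" for x
  define D where "D x = e x * dir_deriv b g x - \<i> * of_real (b \<bullet> \<xi>) * (e x * g x)" for x
  have rg: "rapidly_decreasing g" and rd: "rapidly_decreasing (dir_deriv b g)"
    using g b by (auto intro: schwartz_rapidly_decreasing schwartz_dir_deriv)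
  have [measurable]: "g \<in> borel_measurable borel" "dir_deriv b g \<in> borel_measurable borel"
    using rg rd by (auto simp: rapidly_decreasing_def)
  note ig = rapidly_decreasing_integrable[OF rg] rapidly_decreasing_integrable[OF rd]
  obtain C1 where C1: "C1 \<ge> 0" "\<And>x. norm (g x) \<le> C1 * decay_weight x"
    using rapidly_decreasing_weight_bound[OF rg] by blast
  obtain C2 where C2: "C2 \<ge> 0" "\<And>x. norm (dir_deriv b g x) \<le> C2 * decay_weight x"
    using rapidly_decreasing_weight_bound[OF rd] by blast
  have "(\<integral>x. D x \<partial>lborel) = 0"
  proof (rule integral_directional_derivative_eq_0)
    show "integrable lborel (\<lambda>x. e x * g x)"
      unfolding e_def by (rule integrable_fourier_integrand[OF ig(1)])
    show "D \<in> borel_measurable borel"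
      unfolding D_def[abs_def] e_def by measurable
    show "norm b \<le> 1" using b by simp
    show "norm (D x) \<le> (C2 + \<bar>b \<bullet> \<xi>\<bar> * C1) * decay_weight x" for x
    proof -
      have "norm (D x) \<le> norm (dir_deriv b g x) + \<bar>b \<bullet> \<xi>\<bar> * norm (g x)"
        unfolding D_def by (rule order_trans[OF norm_triangle_ineq4]) (simp add: norm_mult e_def)
      also have "\<dots> \<le> C2 * decay_weight x + \<bar>b \<bullet> \<xi>\<bar> * (C1 * decay_weight x)"
        by (intro add_mono mult_left_mono C1 C2) auto
      finally show ?thesis by (simp add: algebra_simps)
    qed
    show "0 \<le> C2 + \<bar>b \<bullet> \<xi>\<bar> * C1" using C1 C2 by simp
    show "((\<lambda>t. e (x + t *\<^sub>R b) * g (x + t *\<^sub>R b)) has_vector_derivative D x) (at 0)" for x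
    proof -
      have "((\<lambda>t. - (\<i> * complex_of_real (x \<bullet> \<xi> + t * (b \<bullet> \<xi>)))) has_vector_derivative
          - (\<i> * of_real (b \<bullet> \<xi>))) (at 0)"
        by (auto intro!: derivative_eq_intros)
      from field_vector_diff_chain_at[OF this DERIV_exp]
      have "((\<lambda>t. e (x + t *\<^sub>R b)) has_vector_derivative - (\<i> * of_real (b \<bullet> \<xi>)) * e x) (at 0)"
        by (simp add: o_def e_def inner_add_left)
      from has_vector_derivative_mult[OF this
          has_vector_derivative_dir_deriv[OF schwartz_differentiable[OF g]]]
      show ?thesis by (simp add: D_def algebra_simps)
    qed
  qed
  moreover have "(\<integral>x. D x \<partial>lborel) = fourier (dir_deriv b g) \<xi> - \<i> * of_real (b \<bullet> \<xi>) * fourier g \<xi>"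
    unfolding D_def e_def fourier_def using integrable_fourier_integrand[OF ig(1)] integrable_fourier_integrand[OF ig(2)]
    by simp
  ultimately show ?thesis by simp
qed

text \<open>Since \<open>norm \<xi>\<close> is at most the sum of the
  \<open>\<bar>\<xi> \<bullet> b\<bar>\<close>, each power of it can be traded for partial
  derivatives of \<open>g\<close>. The induction therefore runs over all Schwartz functions at once,
  and starts from the bound of a transform by the integral of the modulus.\<close>

lemma rapidly_decreasing_fourier:
  assumes "schwartz g"
  shows "rapidly_decreasing (fourier g)"
proof -
  have "\<exists>B. \<forall>\<xi>. norm \<xi> ^ j * norm (fourier g \<xi>) \<le> B" for j
    using assms
  proof (induction j arbitrary: g)
    case 0
    then show ?case using norm_fourier_le by auto
  next
    case (Suc j)
    have "\<forall>b\<in>Basis. \<exists>B. \<forall>\<xi>. norm \<xi> ^ j * norm (fourier (dir_deriv b g) \<xi>) \<le> B"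
      using Suc schwartz_dir_deriv by blast
    then obtain B where B: "\<And>b \<xi>. b \<in> Basis \<Longrightarrow> norm \<xi> ^ j * norm (fourier (dir_deriv b g) \<xi>) \<le> B b"
      by metis
    have "norm \<xi> ^ Suc j * norm (fourier g \<xi>) \<le> (\<Sum>b\<in>Basis. B b)" for \<xi>
    proof -
      have "norm \<xi> ^ Suc j * norm (fourier g \<xi>) = norm \<xi> * (norm \<xi> ^ j * norm (fourier g \<xi>))" by simp
      also have "\<dots> \<le> (\<Sum>b\<in>Basis. \<bar>\<xi> \<bullet> b\<bar>) * (norm \<xi> ^ j * norm (fourier g \<xi>))"
        by (intro mult_right_mono norm_le_l1) auto
      also have "\<dots> = (\<Sum>b\<in>Basis. norm \<xi> ^ j * norm (fourier (dir_deriv b g) \<xi>))"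
        unfolding sum_distrib_right
        by (intro sum.cong refl)
          (simp add: fourier_dir_deriv[OF Suc.prems] norm_mult inner_commute)
      also have "\<dots> \<le> (\<Sum>b\<in>Basis. B b)" by (intro sum_mono B)
      finally show ?thesis .
    qed
    then show ?case by blast
  qed
  moreover have "fourier g \<in> borel_measurable borel"
    using assms by (intro borel_measurable_continuous_onI continuous_on_fourier
        rapidly_decreasing_integrable schwartz_rapidly_decreasing)
  ultimately show ?thesis unfolding rapidly_decreasing_def by blast
qed

section \<open>Fourier inversion\<close>

text \<open>Variance 1 in every coordinate makes the Gaussian an eigenfunction of
  \<open>fourier\<close>. The definition is used on the whole space and also on \<open>real\<close>,
  for the factors.\<close>

definition gaussian :: "'a::euclidean_space \<Rightarrow> complex"
  where "gaussian x = of_real (exp (- (norm x)\<^sup>2 / 2))"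

lemma gaussian_0 [simp]: "gaussian 0 = 1"
  by (simp add: gaussian_def)

lemma norm_gaussian_le_1: "cmod (gaussian x) \<le> 1"
  by (simp add: gaussian_def)

lemma continuous_on_gaussian: "continuous_on UNIV gaussian"
  unfolding gaussian_def[abs_def] by (intro continuous_intros) auto

lemma borel_measurable_gaussian [measurable]: "gaussian \<in> borel_measurable borel"
  by (rule borel_measurable_continuous_onI[OF continuous_on_gaussian])

lemma gaussian_real_eq: "gaussian (x::real) = of_real (sqrt (2 * pi) * std_normal_density x)"
  by (simp add: gaussian_def std_normal_density_def)

lemma integrable_gaussian_real: "integrable lborel (gaussian :: real \<Rightarrow> complex)"
  unfolding gaussian_real_eq[abs_def] by (intro integrable_of_real integrable_mult_right) simp

text \<open>The characteristic function of the standard normal distribution has the kernel with the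
  opposite sign, hence its argument \<open>- t\<close>; the sign disappears because the Gaussian is
  even.\<close>

lemma fourier_gaussian_real: "fourier gaussian (t::real) = of_real (sqrt (2 * pi)) * gaussian t"
proof -
  have "gaussian t = char std_normal_distribution (- t)"
    by (simp add: char_std_normal_distribution gaussian_def)
  also have "\<dots> = (\<integral>x. std_normal_density x *\<^sub>R iexp (- t * x) \<partial>lborel)"
    unfolding char_def by (subst integral_density) auto
  finally have "of_real (sqrt (2 * pi)) * gaussian t =
      of_real (sqrt (2 * pi)) * (\<integral>x. std_normal_density x *\<^sub>R iexp (- t * x) \<partial>lborel)" by simp
  also have "\<dots> = (\<integral>x. of_real (sqrt (2 * pi)) * (std_normal_density x *\<^sub>R iexp (- t * x)) \<partial>lborel)"
    by (rule integral_mult_right_zero[symmetric])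
  also have "\<dots> = fourier gaussian t"
    unfolding fourier_def gaussian_real_eq
    by (intro Bochner_Integration.integral_cong) (simp_all add: scaleR_conv_of_real mult_ac)
  finally show ?thesis ..
qed

lemma gaussian_eq_prod: "gaussian x = (\<Prod>b\<in>Basis. gaussian (x \<bullet> b))"
proof -
  have "(norm x)\<^sup>2 = (\<Sum>b\<in>Basis. (x \<bullet> b)\<^sup>2)"
    unfolding power2_norm_eq_inner by (subst euclidean_inner) (simp add: power2_eq_square)
  then have "exp (- (norm x)\<^sup>2 / 2) = (\<Prod>b\<in>Basis. exp (- (x \<bullet> b)\<^sup>2 / 2))"
    by (simp add: exp_sum[symmetric] sum_negf[symmetric] sum_divide_distrib)
  then show ?thesis by (simp add: gaussian_def)
qed

lemma integrable_gaussian: "integrable lborel gaussian"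
  by (subst gaussian_eq_prod[abs_def])
    (intro integrable_lborel_prod_component integrable_gaussian_real)

text \<open>Both the kernel and the Gaussian are products over the coordinates, which reduces the
  claim to the real line.\<close>

lemma fourier_gaussian:
  fixes \<xi> :: "'a::euclidean_space"
  shows "fourier gaussian \<xi> = of_real (sqrt (2 * pi) ^ DIM('a)) * gaussian \<xi>"
proof -
  have "exp (- (\<i> * complex_of_real (x \<bullet> \<xi>))) =
      (\<Prod>b\<in>Basis. exp (- (\<i> * complex_of_real ((x \<bullet> b) \<bullet> (\<xi> \<bullet> b)))))" for x
    by (subst euclidean_inner) (simp add: exp_sum[symmetric] sum_negf[symmetric] sum_distrib_left)
  then have "fourier gaussian \<xi> = (\<integral>x. (\<Prod>b\<in>Basis.
      exp (- (\<i> * complex_of_real ((x \<bullet> b) \<bullet> (\<xi> \<bullet> b)))) * gaussian (x \<bullet> b)) \<partial>lborel)"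
    unfolding fourier_def by (simp add: gaussian_eq_prod[of "_ :: 'a"] prod.distrib)
  also have "\<dots> = (\<Prod>b\<in>Basis. fourier gaussian (\<xi> \<bullet> b))"
    unfolding fourier_def
    by (rule integral_lborel_prod_component) (rule integrable_fourier_integrand[OF integrable_gaussian_real])
  also have "\<dots> = of_real (sqrt (2 * pi) ^ DIM('a)) * gaussian \<xi>"
    by (simp add: fourier_gaussian_real prod.distrib gaussian_eq_prod[of \<xi>])
  finally show ?thesis .
qed

text \<open>The Gaussian factor makes the double integral behind \<open>fourier (fourier g)\<close>
  absolutely convergent, so that the order can be exchanged. The inner integral is then the
  transform of a Gaussian, and the outer one becomes an average of \<open>g\<close> that
  concentrates at \<open>- x\<close> as \<open>\<epsilon>\<close> tends to 0.\<close>

lemma fourier_gaussian_mollifier: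
  fixes g :: "'a::euclidean_space \<Rightarrow> complex"
  assumes g: "integrable lborel g" and \<epsilon>: "\<epsilon> > 0"
  shows "fourier (\<lambda>w. fourier g w * gaussian (\<epsilon> *\<^sub>R w)) x =
    of_real (sqrt (2 * pi) ^ DIM('a)) * (\<integral>u. g (- x + \<epsilon> *\<^sub>R u) * gaussian u \<partial>lborel)"
proof -
  let ?d = "DIM('a)" and ?s = "complex_of_real (sqrt (2 * pi) ^ DIM('a))"
  define e where "e t = exp (- (\<i> * complex_of_real t))" for t
  have [measurable]: "g \<in> borel_measurable borel" using borel_measurable_integrable[OF g] by simp
  have [measurable]: "e \<in> borel_measurable borel" unfolding e_def[abs_def] by measurable
  have e_add: "e (s + t) = e s * e t" for s t
    by (simp add: e_def exp_add[symmetric] algebra_simps)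
  have ge: "integrable lborel (\<lambda>w :: 'a. gaussian (\<epsilon> *\<^sub>R w))"
  proof -
    have "integrable (density (distr lborel borel (\<lambda>x::'a. 0 + \<epsilon> *\<^sub>R x)) (\<lambda>_. \<bar>\<epsilon>\<bar> ^ ?d)) (gaussian :: 'a \<Rightarrow> complex)"
      using integrable_gaussian lborel_affine[of \<epsilon> "0::'a"] \<epsilon> by simp
    then have "integrable lborel (\<lambda>w. \<epsilon> ^ ?d *\<^sub>R (gaussian (\<epsilon> *\<^sub>R w :: 'a) :: complex))"
      using \<epsilon> by (simp add: ennreal_power integrable_density integrable_distr_eq)
    then have "integrable lborel (\<lambda>w. inverse (\<epsilon> ^ ?d) *\<^sub>R (\<epsilon> ^ ?d *\<^sub>R (gaussian (\<epsilon> *\<^sub>R w :: 'a) :: complex)))"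
      by (rule integrable_scaleR_right)
    then show ?thesis using \<epsilon> by simp
  qed
  \<comment> \<open>The substitution \<open>u = \<epsilon> *\<^sub>R w\<close> in the transform of
    the Gaussian at \<open>(x + z) /\<^sub>R \<epsilon>\<close>.\<close>
  have inner: "(\<integral>w. e (w \<bullet> (x + z)) * gaussian (\<epsilon> *\<^sub>R w) \<partial>lborel) =
      of_real (inverse (\<epsilon> ^ ?d)) * (?s * gaussian ((x + z) /\<^sub>R \<epsilon>))" for z
  proof -
    have "?s * gaussian ((x + z) /\<^sub>R \<epsilon>) = (\<integral>u. e (u \<bullet> ((x + z) /\<^sub>R \<epsilon>)) * gaussian u \<partial>lborel)"
      unfolding fourier_gaussian[symmetric] fourier_def e_def ..
    also have "\<dots> = \<bar>\<epsilon>\<bar> ^ ?d *\<^sub>R (\<integral>w. e ((0 + \<epsilon> *\<^sub>R w) \<bullet> ((x + z) /\<^sub>R \<epsilon>)) * gaussian (0 + \<epsilon> *\<^sub>R w) \<partial>lborel)"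
      by (rule lborel_affine_substitution) (use \<epsilon> in auto)
    also have "\<dots> = of_real (\<epsilon> ^ ?d) * (\<integral>w. e (w \<bullet> (x + z)) * gaussian (\<epsilon> *\<^sub>R w) \<partial>lborel)"
    proof -
      have "(0 + \<epsilon> *\<^sub>R w) \<bullet> ((x + z) /\<^sub>R \<epsilon>) = w \<bullet> (x + z)" for w
        using \<epsilon> by simp
      then show ?thesis using \<epsilon> by (simp add: scaleR_conv_of_real del: inner_scaleR_left inner_scaleR_right)
    qed
    finally show ?thesis using \<epsilon> by simp
  qed
  have "fourier (\<lambda>w. fourier g w * gaussian (\<epsilon> *\<^sub>R w)) x =
      (\<integral>w. (\<integral>z. e (w \<bullet> (x + z)) * gaussian (\<epsilon> *\<^sub>R w) * g z \<partial>lborel) \<partial>lborel)"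
    unfolding fourier_def e_def[symmetric]
  proof (rule Bochner_Integration.integral_cong[OF refl])
    fix w :: 'a
    have "e (w \<bullet> x) * ((\<integral>z. e (z \<bullet> w) * g z \<partial>lborel) * gaussian (\<epsilon> *\<^sub>R w)) =
        (e (w \<bullet> x) * gaussian (\<epsilon> *\<^sub>R w)) * (\<integral>z. e (z \<bullet> w) * g z \<partial>lborel)" by simp
    also have "\<dots> = (\<integral>z. (e (w \<bullet> x) * gaussian (\<epsilon> *\<^sub>R w)) * (e (z \<bullet> w) * g z) \<partial>lborel)"
      by (rule integral_mult_right_zero[symmetric])
    also have "\<dots> = (\<integral>z. e (w \<bullet> (x + z)) * gaussian (\<epsilon> *\<^sub>R w) * g z \<partial>lborel)"
      by (simp add: inner_add_right e_add inner_commute[of w] mult_ac)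
    finally show "e (w \<bullet> x) * ((\<integral>z. e (z \<bullet> w) * g z \<partial>lborel) * gaussian (\<epsilon> *\<^sub>R w)) =
        (\<integral>z. e (w \<bullet> (x + z)) * gaussian (\<epsilon> *\<^sub>R w) * g z \<partial>lborel)" .
  qed
  \<comment> \<open>Fubini applies: the kernel has modulus 1, and what remains is a product of
    integrable functions of \<open>w\<close> and of \<open>z\<close>.\<close>
  also have "\<dots> = (\<integral>z. (\<integral>w. e (w \<bullet> (x + z)) * gaussian (\<epsilon> *\<^sub>R w) * g z \<partial>lborel) \<partial>lborel)"
  proof (rule lborel_pair.Fubini_integral, rule lborel_pair.Fubini_integrable)
    show "(\<lambda>(z, w). e (w \<bullet> (x + z)) * gaussian (\<epsilon> *\<^sub>R w) * g z) \<in> borel_measurable (lborel \<Otimes>\<^sub>M lborel)"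
      by measurable
    have ne: "cmod (e t) = 1" for t by (simp add: e_def)
    show "integrable lborel (\<lambda>z. \<integral>w. norm (case (z, w) of (z, w) \<Rightarrow>
        e (w \<bullet> (x + z)) * gaussian (\<epsilon> *\<^sub>R w) * g z) \<partial>lborel)"
      by (simp add: norm_mult ne g)
    show "AE z in lborel. integrable lborel (\<lambda>w. case (z, w) of (z, w) \<Rightarrow>
        e (w \<bullet> (x + z)) * gaussian (\<epsilon> *\<^sub>R w) * g z)"
      unfolding prod.case e_def
      by (intro AE_I2 integrable_mult_left integrable_fourier_integrand ge)
  qed
  also have "\<dots> = (\<integral>z. of_real (inverse (\<epsilon> ^ ?d)) * (?s * gaussian ((x + z) /\<^sub>R \<epsilon>)) * g z \<partial>lborel)"
    by (simp add: inner)
  \<comment> \<open>The substitution \<open>z = - x + \<epsilon> *\<^sub>R u\<close> removes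
    \<open>\<epsilon>\<close> from the Gaussian; its Jacobian cancels
    \<open>inverse (\<epsilon> ^ ?d)\<close>.\<close>
  also have "\<dots> = \<bar>\<epsilon>\<bar> ^ ?d *\<^sub>R (\<integral>u. of_real (inverse (\<epsilon> ^ ?d)) *
      (?s * gaussian ((x + (- x + \<epsilon> *\<^sub>R u)) /\<^sub>R \<epsilon>)) * g (- x + \<epsilon> *\<^sub>R u) \<partial>lborel)"
    by (rule lborel_affine_substitution) (use \<epsilon> in auto)
  also have "\<dots> = of_real (\<epsilon> ^ ?d) * (\<integral>u. of_real (inverse (\<epsilon> ^ ?d)) * ?s *
      (g (- x + \<epsilon> *\<^sub>R u) * gaussian u) \<partial>lborel)"
    using \<epsilon> by (simp add: scaleR_conv_of_real mult_ac)
  also have "\<dots> = ?s * (\<integral>u. g (- x + \<epsilon> *\<^sub>R u) * gaussian u \<partial>lborel)"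
    unfolding integral_mult_right_zero using \<epsilon> by simp
  finally show ?thesis .
qed

text \<open>In the regularised identity \<open>\<epsilon>\<close> tends to 0 along a sequence. The
  left side is dominated by \<open>cmod (fourier g w)\<close>, the right side by
  \<open>B * cmod (gaussian u)\<close>, and the latter tends to a multiple of
  \<open>g (- x)\<close>. The reflection appears because the forward transform is applied
  twice.\<close>

lemma fourier_inversion:
  fixes g :: "'a::euclidean_space \<Rightarrow> complex"
  assumes g: "integrable lborel g" "continuous_on UNIV g" and B: "\<And>x. cmod (g x) \<le> B"
    and ghat: "integrable lborel (fourier g)"
  shows "fourier (fourier g) x = of_real ((2 * pi) ^ DIM('a)) * g (- x)"
proof -
  let ?s = "complex_of_real (sqrt (2 * pi) ^ DIM('a))"
  define \<epsilon> where "\<epsilon> n = inverse (real (Suc n))" for n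
  have pos: "\<epsilon> n > 0" for n by (simp add: \<epsilon>_def)
  have lim: "\<epsilon> \<longlonglongrightarrow> 0" unfolding \<epsilon>_def[abs_def] by (rule LIMSEQ_inverse_real_of_nat)
  have [measurable]: "g \<in> borel_measurable borel" using borel_measurable_integrable[OF g(1)] by simp
  have [measurable]: "fourier g \<in> borel_measurable borel" using borel_measurable_integrable[OF ghat] by simp
  have "(\<lambda>n. fourier (\<lambda>w. fourier g w * gaussian (\<epsilon> n *\<^sub>R w)) x) \<longlonglongrightarrow> fourier (fourier g) x"
    unfolding fourier_def[of _ x]
  proof (rule integral_dominated_convergence[where w = "\<lambda>w. cmod (fourier g w)"])
    show "AE w in lborel. (\<lambda>n. exp (- (\<i> * of_real (w \<bullet> x))) * (fourier g w * gaussian (\<epsilon> n *\<^sub>R w)))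
        \<longlonglongrightarrow> exp (- (\<i> * of_real (w \<bullet> x))) * fourier g w"
    proof (rule AE_I2)
      fix w :: 'a
      have "(\<lambda>n. \<epsilon> n *\<^sub>R w) \<longlonglongrightarrow> 0" by (rule tendsto_eq_intros lim refl)+ simp
      then have "(\<lambda>n. gaussian (\<epsilon> n *\<^sub>R w)) \<longlonglongrightarrow> gaussian (0::'a)"
        by (rule continuous_on_tendsto_compose[OF continuous_on_gaussian]) auto
      then have "(\<lambda>n. exp (- (\<i> * of_real (w \<bullet> x))) * (fourier g w * gaussian (\<epsilon> n *\<^sub>R w)))
          \<longlonglongrightarrow> exp (- (\<i> * of_real (w \<bullet> x))) * (fourier g w * gaussian (0::'a))"
        by (intro tendsto_mult tendsto_const)
      then show "(\<lambda>n. exp (- (\<i> * of_real (w \<bullet> x))) * (fourier g w * gaussian (\<epsilon> n *\<^sub>R w)))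
          \<longlonglongrightarrow> exp (- (\<i> * of_real (w \<bullet> x))) * fourier g w" by simp
    qed
    show "AE w in lborel. norm (exp (- (\<i> * of_real (w \<bullet> x))) * (fourier g w * gaussian (\<epsilon> n *\<^sub>R w)))
        \<le> cmod (fourier g w)" for n
      by (intro AE_I2) (simp add: norm_mult mult_left_le norm_gaussian_le_1)
    show "integrable lborel (\<lambda>w. cmod (fourier g w))" using ghat by simp
  qed measurable
  moreover have "(\<lambda>n. \<integral>u. g (- x + \<epsilon> n *\<^sub>R u) * gaussian u \<partial>lborel) \<longlonglongrightarrow>
      (\<integral>u. g (- x) * gaussian (u :: 'a) \<partial>lborel)"
  proof (rule integral_dominated_convergence[where w = "\<lambda>u :: 'a. B * cmod (gaussian u)"])
    show "AE u in lborel. (\<lambda>n. g (- x + \<epsilon> n *\<^sub>R u) * gaussian u) \<longlonglongrightarrow> g (- x) * gaussian u"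
    proof (rule AE_I2)
      fix u :: 'a
      have "(\<lambda>n. - x + \<epsilon> n *\<^sub>R u) \<longlonglongrightarrow> - x" by (rule tendsto_eq_intros lim refl)+ simp
      then have "(\<lambda>n. g (- x + \<epsilon> n *\<^sub>R u)) \<longlonglongrightarrow> g (- x)"
        by (rule continuous_on_tendsto_compose[OF g(2)]) auto
      then show "(\<lambda>n. g (- x + \<epsilon> n *\<^sub>R u) * gaussian u) \<longlonglongrightarrow> g (- x) * gaussian u"
        by (intro tendsto_mult tendsto_const)
    qed
    show "AE u in lborel. norm (g (- x + \<epsilon> n *\<^sub>R u) * gaussian u) \<le> B * cmod (gaussian u)" for n
      by (intro AE_I2) (simp add: norm_mult mult_right_mono B)
    show "integrable lborel (\<lambda>u :: 'a. B * cmod (gaussian u))"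
      by (intro integrable_mult_right integrable_norm integrable_gaussian)
  qed measurable
  ultimately have "fourier (fourier g) x = ?s * (\<integral>u. g (- x) * gaussian (u :: 'a) \<partial>lborel)"
    unfolding fourier_gaussian_mollifier[OF g(1) pos] by (rule LIMSEQ_unique[OF _ tendsto_mult_left])
  \<comment> \<open>The mass of the Gaussian is its transform at 0, which is a second factor
    \<open>?s\<close>; the two together give the power of \<open>2 * pi\<close>.\<close>
  also have "\<dots> = ?s * (g (- x) * fourier gaussian (0::'a))"
    by (simp add: fourier_def)
  also have "\<dots> = (?s * ?s) * g (- x)"
    by (simp add: fourier_gaussian)
  also have "?s * ?s = of_real ((2 * pi) ^ DIM('a))"
    unfolding of_real_mult[symmetric] power_mult_distrib[symmetric] by simp
  finally show ?thesis .
qed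

section \<open>The cone transform\<close>

text \<open>The last hypothesis keeps \<open>T\<close> from bringing far points close to the origin,
  so decay in \<open>T x\<close> is decay in \<open>x\<close>. It holds for shears and for the
  embedding of a slice.\<close>

lemma rapidly_decreasing_compose:
  fixes g :: "'b::euclidean_space \<Rightarrow> complex" and T :: "'a::euclidean_space \<Rightarrow> 'b"
  assumes g: "rapidly_decreasing g" and T: "continuous_on UNIV T"
    and K: "\<And>x. norm x \<le> K * norm (T x)"
  shows "rapidly_decreasing (\<lambda>x. g (T x))"
  unfolding rapidly_decreasing_def
proof (intro conjI allI)
  have "T \<in> borel_measurable borel" using T by (rule borel_measurable_continuous_onI)
  then show "(\<lambda>x. g (T x)) \<in> borel_measurable borel"
    using g unfolding rapidly_decreasing_def by (auto intro: measurable_compose)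
  fix j :: nat
  obtain B where B: "\<And>y. norm y ^ j * norm (g y) \<le> B"
    using g unfolding rapidly_decreasing_def by meson
  have "norm x ^ j * norm (g (T x)) \<le> \<bar>K\<bar> ^ j * B" for x
  proof -
    \<comment> \<open>No sign of \<open>K\<close> is assumed, hence the absolute value before taking
      powers.\<close>
    have "norm x \<le> \<bar>K\<bar> * norm (T x)"
      by (rule order_trans[OF K]) (intro mult_right_mono, auto)
    then have "norm x ^ j \<le> \<bar>K\<bar> ^ j * norm (T x) ^ j"
      by (metis norm_ge_zero power_mono power_mult_distrib)
    then have "norm x ^ j * norm (g (T x)) \<le> \<bar>K\<bar> ^ j * (norm (T x) ^ j * norm (g (T x)))"
      by (metis mult.assoc mult_right_mono norm_ge_zero)
    also have "\<dots> \<le> \<bar>K\<bar> ^ j * B" by (intro mult_left_mono B) auto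
    finally show ?thesis .
  qed
  then show "\<exists>B. \<forall>x. norm x ^ j * norm (g (T x)) \<le> B" by blast
qed

text \<open>Fubini, as the kernel is a product of one in \<open>\<xi>\<close> and one in
  \<open>\<eta>\<close>. This carries the decay of the full transform of \<open>f\<close> over to
  the slices.\<close>

lemma fourier_prod:
  fixes f :: "'a::euclidean_space \<times> 'a \<Rightarrow> complex"
  assumes f: "integrable lborel f"
  shows "fourier f (\<xi>, \<eta>) = fourier (\<lambda>y. fourier_fst f (\<xi>, y)) \<eta>"
proof -
  let ?k = "\<lambda>x y. exp (- (\<i> * complex_of_real ((x, y) \<bullet> (\<xi>, \<eta>)))) * f (x, y)"
  have "integrable (lborel \<Otimes>\<^sub>M lborel) (case_prod ?k)"
    using integrable_fourier_integrand[OF f, of "(\<xi>, \<eta>)"] by (simp add: lborel_prod case_prod_unfold inner_prod_def)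
  then have *: "(\<integral>y. (\<integral>x. ?k x y \<partial>lborel) \<partial>lborel) = integral\<^sup>L (lborel \<Otimes>\<^sub>M lborel) (case_prod ?k)"
    by (rule lborel_pair.integral_snd)
  have "fourier f (\<xi>, \<eta>) = integral\<^sup>L (lborel \<Otimes>\<^sub>M lborel) (case_prod ?k)"
    unfolding fourier_def by (simp add: lborel_prod case_prod_unfold inner_prod_def)
  also have "\<dots> = (\<integral>y. (\<integral>x. ?k x y \<partial>lborel) \<partial>lborel)" by (rule *[symmetric])
  also have "\<dots> = fourier (\<lambda>y. fourier_fst f (\<xi>, y)) \<eta>"
  proof -
    have "(\<integral>x. ?k x y \<partial>lborel) =
      exp (- (\<i> * of_real (y \<bullet> \<eta>))) * fourier_fst f (\<xi>, y)" for y
    unfolding fourier_fst_def fourier_def prod.case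
    by (subst integral_mult_right_zero[symmetric])
      (simp add: inner_prod_def exp_add[symmetric] algebra_simps)
    then show ?thesis unfolding fourier_def[of _ \<eta>] by simp
  qed
  finally show ?thesis .
qed

text \<open>Substituting \<open>U x\<close> for \<open>x\<close> preserves the measure and
  \<open>g\<close>, and \<open>U x \<bullet> U \<xi> = x \<bullet> \<xi>\<close>.\<close>

lemma fourier_orthogonal:
  fixes g :: "'a::euclidean_space \<Rightarrow> complex"
  assumes U: "orthogonal_transformation U" and g[measurable]: "g \<in> borel_measurable borel"
    and inv: "\<And>x. g (U x) = g x"
  shows "fourier g (U \<xi>) = fourier g \<xi>"
proof -
  have [measurable]: "U \<in> borel_measurable borel"
    using orthogonal_transformation_linear[OF U]
    by (auto intro!: borel_measurable_continuous_onI linear_continuous_on simp: linear_conv_bounded_linear)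
  have "fourier g (U \<xi>) = (\<integral>x. exp (- (\<i> * of_real (x \<bullet> U \<xi>))) * g x \<partial>distr lborel borel U)"
    unfolding fourier_def lborel_distr_orthogonal[OF U] ..
  also have "\<dots> = (\<integral>x. exp (- (\<i> * of_real (U x \<bullet> U \<xi>))) * g (U x) \<partial>lborel)"
    by (rule integral_distr) measurable
  also have "\<dots> = fourier g \<xi>"
    using U by (simp add: fourier_def inv orthogonal_transformation_def)
  finally show ?thesis .
qed

lemma fourier_scale:
  fixes h :: "'a::euclidean_space \<Rightarrow> complex"
  assumes [measurable]: "h \<in> borel_measurable borel" and c: "c > 0"
  shows "fourier h \<eta> = of_real (c ^ DIM('a)) * fourier (\<lambda>v. h (c *\<^sub>R v)) (c *\<^sub>R \<eta>)"
proof -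
  have "fourier h \<eta> = \<bar>c\<bar> ^ DIM('a) *\<^sub>R
      (\<integral>x. exp (- (\<i> * of_real ((0 + c *\<^sub>R x) \<bullet> \<eta>))) * h (0 + c *\<^sub>R x) \<partial>lborel)"
    unfolding fourier_def by (rule lborel_affine_substitution) (use c in auto)
  then show ?thesis
    using c by (simp add: fourier_def scaleR_conv_of_real)
qed

text \<open>The four conclusions are what \<open>fourier_inversion\<close> asks of the slice at
  \<open>\<xi>\<close>. For the last one, the transform of the slice is itself a slice of
  \<open>fourier f\<close>, which decreases rapidly.\<close>

lemma fourier_fst_slice:
  fixes f :: "'a::euclidean_space \<times> 'a \<Rightarrow> complex"
  assumes f: "schwartz f"
  shows integrable_fourier_fst_slice: "integrable lborel (\<lambda>y. fourier_fst f (\<xi>, y))"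
    and continuous_on_fourier_fst_slice: "continuous_on UNIV (\<lambda>y. fourier_fst f (\<xi>, y))"
    and bounded_fourier_fst_slice: "\<exists>B. \<forall>y. cmod (fourier_fst f (\<xi>, y)) \<le> B"
    and integrable_fourier_fourier_fst_slice:
      "integrable lborel (fourier (\<lambda>y. fourier_fst f (\<xi>, y)))"
proof -
  have rf: "rapidly_decreasing f" using f by (rule schwartz_rapidly_decreasing)
  note i = rapidly_decreasing_integrable[OF rf]
  have cont: "continuous_on UNIV f" using f by (rule schwartz_continuous)
  then have [measurable]: "f \<in> borel_measurable borel" by (rule borel_measurable_continuous_onI)
  have sect: "(\<lambda>x. f (x, y)) \<in> borel_measurable borel" for y
    by (intro borel_measurable_continuous_onI continuous_on_compose2[OF cont] continuous_intros) auto
  obtain C where C: "C \<ge> 0" "\<And>p. norm (f p) \<le> C * decay_weight p"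
    using rapidly_decreasing_weight_bound[OF rf] by blast
  \<comment> \<open>The bound does not involve \<open>y\<close>: it dominates the integrands both
    for the continuity and for the boundedness of the slice.\<close>
  have bnd: "norm (f (x, y)) \<le> C * decay_weight x" for x y
    by (rule order_trans[OF C(2)]) (intro mult_left_mono decay_weight_fst C(1))
  have iw: "integrable lborel (\<lambda>x::'a. C * decay_weight x)"
    by (intro integrable_mult_right integrable_decay_weight)
  have isect: "integrable lborel (\<lambda>x. f (x, y))" for y
  proof (rule Bochner_Integration.integrable_bound[OF iw])
    show "AE x in lborel. norm (f (x, y)) \<le> norm (C * decay_weight x)"
      by (intro AE_I2 order_trans[OF bnd]) simp
  qed (use sect in simp)
  show "integrable lborel (\<lambda>y. fourier_fst f (\<xi>, y))"
  proof -
    \<comment> \<open>At the frequency \<open>(\<xi>, 0)\<close> the kernel depends on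
      \<open>x\<close> only, so integrating out \<open>x\<close> leaves the slice.\<close>
    have "integrable (lborel \<Otimes>\<^sub>M lborel) (\<lambda>(x, y). exp (- (\<i> * complex_of_real ((x, y) \<bullet> (\<xi>, 0)))) * f (x, y))"
      using integrable_fourier_integrand[OF i, of "(\<xi>, 0)"] by (simp add: lborel_prod case_prod_unfold inner_prod_def)
    then have "integrable lborel (\<lambda>y. \<integral>x. exp (- (\<i> * complex_of_real ((x, y) \<bullet> (\<xi>, 0)))) * f (x, y) \<partial>lborel)"
      by (rule lborel_pair.integrable_snd)
    then show ?thesis by (simp add: fourier_fst_def fourier_def inner_prod_def)
  qed
  show "continuous_on UNIV (\<lambda>y. fourier_fst f (\<xi>, y))"
    unfolding continuous_on_sequentially
  proof (intro ballI allI impI)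
    fix X :: "nat \<Rightarrow> 'a" and a
    assume X: "(\<forall>n. X n \<in> UNIV) \<and> X \<longlonglongrightarrow> a"
    have meas: "(\<lambda>x. exp (- (\<i> * of_real (x \<bullet> \<xi>))) * f (x, y)) \<in> borel_measurable lborel" for y
      using borel_measurable_integrable[OF integrable_fourier_integrand[OF isect]] .
    have "(\<lambda>n. fourier (\<lambda>x. f (x, X n)) \<xi>) \<longlonglongrightarrow> fourier (\<lambda>x. f (x, a)) \<xi>"
      unfolding fourier_def
    proof (rule integral_dominated_convergence[where w = "\<lambda>x. C * decay_weight x"])
      show "AE x in lborel. (\<lambda>n. exp (- (\<i> * of_real (x \<bullet> \<xi>))) * f (x, X n)) \<longlonglongrightarrow>
          exp (- (\<i> * of_real (x \<bullet> \<xi>))) * f (x, a)"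
      proof (rule AE_I2)
        fix x :: 'a
        have "(\<lambda>n. (x, X n)) \<longlonglongrightarrow> (x, a)" using X by (intro tendsto_intros) auto
        then have "(\<lambda>n. f (x, X n)) \<longlonglongrightarrow> f (x, a)"
          by (rule continuous_on_tendsto_compose[OF cont]) auto
        then show "(\<lambda>n. exp (- (\<i> * of_real (x \<bullet> \<xi>))) * f (x, X n)) \<longlonglongrightarrow>
            exp (- (\<i> * of_real (x \<bullet> \<xi>))) * f (x, a)"
          by (intro tendsto_mult tendsto_const)
      qed
    qed (use meas iw bnd in \<open>auto simp: norm_mult\<close>)
    then show "((\<lambda>y. fourier_fst f (\<xi>, y)) \<circ> X) \<longlonglongrightarrow> fourier_fst f (\<xi>, a)"
      by (simp add: fourier_fst_def o_def)
  qed
  show "\<exists>B. \<forall>y. cmod (fourier_fst f (\<xi>, y)) \<le> B"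
  proof (intro exI allI)
    fix y
    have "cmod (fourier_fst f (\<xi>, y)) \<le> (\<integral>x. cmod (f (x, y)) \<partial>lborel)"
      unfolding fourier_fst_def prod.case by (rule norm_fourier_le)
    also have "\<dots> \<le> (\<integral>x. C * decay_weight (x::'a) \<partial>lborel)"
      by (intro integral_mono iw bnd integrable_norm isect)
    finally show "cmod (fourier_fst f (\<xi>, y)) \<le> (\<integral>x. C * decay_weight (x::'a) \<partial>lborel)" .
  qed
  have "rapidly_decreasing (\<lambda>\<eta>. fourier f (\<xi>, \<eta>))"
    by (rule rapidly_decreasing_compose[OF rapidly_decreasing_fourier[OF f], where K = 1])
      (auto intro!: continuous_intros norm_snd_le)
  moreover have "fourier (\<lambda>y. fourier_fst f (\<xi>, y)) = (\<lambda>\<eta>. fourier f (\<xi>, \<eta>))"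
    by (rule ext) (rule fourier_prod[OF i, symmetric])
  ultimately show "integrable lborel (fourier (\<lambda>y. fourier_fst f (\<xi>, y)))"
    by (simp add: rapidly_decreasing_integrable)
qed

text \<open>The translation \<open>x = u + norm v *\<^sub>R y\<close> in the inner integral splits
  off from the kernel a factor in \<open>y\<close> alone, which is the kernel of a second transform
  at \<open>- norm v *\<^sub>R \<xi>\<close>.\<close>

lemma fourier_fst_cone_transform:
  fixes f :: "'a::euclidean_space \<times> 'a \<Rightarrow> complex"
  assumes f: "schwartz f"
  shows "fourier_fst (cone_transform f) (\<xi>, v) = fourier (\<lambda>y. fourier_fst f (\<xi>, y)) (- norm v *\<^sub>R \<xi>)"
proof -
  define c where "c = norm v"
  define e where "e t = exp (- (\<i> * complex_of_real t))" for t
  have e_add: "e (s + t) = e s * e t" for s t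
    by (simp add: e_def exp_add[symmetric] algebra_simps)
  have cont: "continuous_on UNIV f" using f by (rule schwartz_continuous)
  \<comment> \<open>Undoing the shear costs \<open>1 + c\<close> in the first component and 1 in the
    second. Hence the sheared \<open>f\<close> is rapidly decreasing on the product space, which
    justifies Fubini.\<close>
  have shear: "norm p \<le> (2 + c) * norm (fst p + c *\<^sub>R snd p, snd p)" for p :: "'a \<times> 'a"
  proof -
    let ?q = "(fst p + c *\<^sub>R snd p, snd p)"
    have "norm (fst p) = norm ((fst p + c *\<^sub>R snd p) - c *\<^sub>R snd p)" by simp
    also have "\<dots> \<le> norm (fst p + c *\<^sub>R snd p) + norm (c *\<^sub>R snd p)" by (rule norm_triangle_ineq4)
    also have "\<dots> \<le> norm ?q + c * norm ?q"
      by (intro add_mono norm_fst_le) (auto simp: c_def intro!: mult_left_mono norm_snd_le)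
    finally have "norm (fst p) \<le> norm ?q + c * norm ?q" .
    moreover have "norm p \<le> norm (fst p) + norm (snd p)"
      by (metis norm_Pair_le prod.collapse)
    moreover have "norm (snd p) \<le> norm ?q" by (rule norm_snd_le)
    ultimately show ?thesis by (simp add: algebra_simps)
  qed
  have "rapidly_decreasing (\<lambda>p. f (fst p + c *\<^sub>R snd p, snd p))"
    by (rule rapidly_decreasing_compose[OF schwartz_rapidly_decreasing[OF f] _ shear])
      (intro continuous_intros)
  then have "integrable lborel (\<lambda>p. exp (- (\<i> * complex_of_real (p \<bullet> (\<xi>, 0)))) * f (fst p + c *\<^sub>R snd p, snd p))"
    by (intro integrable_fourier_integrand rapidly_decreasing_integrable)
  then have int: "integrable (lborel \<Otimes>\<^sub>M lborel) (\<lambda>(u, y). e (u \<bullet> \<xi>) * f (u + c *\<^sub>R y, y))"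
    by (simp add: lborel_prod case_prod_unfold inner_prod_def e_def)
  have "fourier_fst (cone_transform f) (\<xi>, v) =
      (\<integral>u. (\<integral>y. e (u \<bullet> \<xi>) * f (u + c *\<^sub>R y, y) \<partial>lborel) \<partial>lborel)"
    by (simp add: fourier_fst_def fourier_def cone_transform_def e_def c_def)
  also have "\<dots> = (\<integral>y. (\<integral>u. e (u \<bullet> \<xi>) * f (u + c *\<^sub>R y, y) \<partial>lborel) \<partial>lborel)"
    by (rule lborel_pair.Fubini_integral[symmetric, OF int])
  also have "\<dots> = (\<integral>y. e (y \<bullet> (- c *\<^sub>R \<xi>)) * fourier_fst f (\<xi>, y) \<partial>lborel)"
  proof (rule Bochner_Integration.integral_cong[OF refl])
    fix y :: 'a
    have "(\<lambda>x. e (y \<bullet> (- c *\<^sub>R \<xi>)) * (e (x \<bullet> \<xi>) * f (x, y))) \<in> borel_measurable borel"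
      unfolding e_def
      by (intro borel_measurable_continuous_onI continuous_intros continuous_on_compose2[OF cont]) auto
    then have "(\<integral>x. e (y \<bullet> (- c *\<^sub>R \<xi>)) * (e (x \<bullet> \<xi>) * f (x, y)) \<partial>lborel) =
        (\<integral>u. e (y \<bullet> (- c *\<^sub>R \<xi>)) * (e ((c *\<^sub>R y + u) \<bullet> \<xi>) * f (c *\<^sub>R y + u, y)) \<partial>lborel)"
      by (rule lborel_integral_translate[symmetric])
    moreover have "(\<integral>x. e (y \<bullet> (- c *\<^sub>R \<xi>)) * (e (x \<bullet> \<xi>) * f (x, y)) \<partial>lborel) =
        e (y \<bullet> (- c *\<^sub>R \<xi>)) * fourier_fst f (\<xi>, y)"
      unfolding integral_mult_right_zero by (simp add: fourier_fst_def fourier_def e_def)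
    moreover have "e (y \<bullet> (- c *\<^sub>R \<xi>)) * (e ((c *\<^sub>R y + u) \<bullet> \<xi>) * f (c *\<^sub>R y + u, y)) =
        e (u \<bullet> \<xi>) * f (u + c *\<^sub>R y, y)" for u
      by (simp add: mult.assoc[symmetric] e_add[symmetric] inner_add_left add.commute)
    ultimately show "(\<integral>u. e (u \<bullet> \<xi>) * f (u + c *\<^sub>R y, y) \<partial>lborel) =
        e (y \<bullet> (- c *\<^sub>R \<xi>)) * fourier_fst f (\<xi>, y)" by (simp only:)
  qed
  finally show ?thesis
    unfolding fourier_def[of _ "- norm v *\<^sub>R \<xi>"] e_def c_def .
qed

lemma fourier_slice_cone_transform:
  fixes f :: "(real ^ 'm) \<times> (real ^ 'm) \<Rightarrow> complex"
  assumes f: "schwartz_radial f" and \<xi>: "\<xi> \<noteq> 0"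
  shows "fourier_fst f (\<xi>, y) = of_real (norm \<xi> ^ CARD('m) / (2 * pi) ^ CARD('m)) *
    fourier_both (cone_transform f) (\<xi>, norm \<xi> *\<^sub>R y)"
proof -
  define G where "G y = fourier_fst f (\<xi>, y)" for y
  have sf: "schwartz f" and rad: "\<And>U x y. orthogonal_transformation U \<Longrightarrow> f (x, U y) = f (x, y)"
    using f unfolding schwartz_radial_def by metis+
  note G = fourier_fst_slice[OF sf, of \<xi>, folded G_def]
  obtain B where B: "\<And>y. cmod (G y) \<le> B" using G(3) by blast
  have [measurable]: "G \<in> borel_measurable borel"
    using G(2) by (rule borel_measurable_continuous_onI)
  have GU: "G (U y) = G y" if "orthogonal_transformation U" for U y
    using rad[OF that] by (simp add: G_def fourier_fst_def)
  have "fourier_fst (cone_transform f) (\<xi>, v) = fourier G (norm \<xi> *\<^sub>R v)" for v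
  proof -
    \<comment> \<open>Points of equal norm are related by an orthogonal transformation, under which
      the transform of the radial \<open>G\<close> is invariant.\<close>
    have "norm (- norm v *\<^sub>R \<xi>) = norm (norm \<xi> *\<^sub>R v)" by simp
    then obtain U where U: "orthogonal_transformation U" "U (- norm v *\<^sub>R \<xi>) = norm \<xi> *\<^sub>R v"
      by (rule orthogonal_transformation_exists)
    have "fourier_fst (cone_transform f) (\<xi>, v) = fourier G (- norm v *\<^sub>R \<xi>)"
      unfolding G_def by (rule fourier_fst_cone_transform[OF sf])
    also have "\<dots> = fourier G (norm \<xi> *\<^sub>R v)"
      unfolding U(2)[symmetric] by (rule fourier_orthogonal[symmetric]) (simp_all add: U(1) GU)
    finally show ?thesis .
  qed
  then have "of_real (norm \<xi> ^ CARD('m)) * fourier_both (cone_transform f) (\<xi>, norm \<xi> *\<^sub>R y) =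
      of_real (norm \<xi> ^ CARD('m)) * fourier (\<lambda>v. fourier G (norm \<xi> *\<^sub>R v)) (norm \<xi> *\<^sub>R y)"
    by (simp add: fourier_both_def)
  \<comment> \<open>The power of \<open>norm \<xi>\<close> is the Jacobian of the dilation by
    \<open>norm \<xi>\<close>, which is positive because \<open>\<xi> \<noteq> 0\<close>.\<close>
  also have "\<dots> = fourier (fourier G) y"
    using fourier_scale[of "fourier G" "norm \<xi>" y] borel_measurable_integrable[OF G(4)] \<xi> by simp
  also have "\<dots> = of_real ((2 * pi) ^ CARD('m)) * G (- y)"
    using fourier_inversion[OF G(1,2) B G(4)] by simp
  \<comment> \<open>The reflection is an orthogonal transformation, so radiality removes the sign
    left by the inversion.\<close>
  also have "G (- y) = G y"
    by (rule GU) (simp add: orthogonal_transformation_neg)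
  finally show ?thesis unfolding G_def by (simp add: field_simps)
qed

section \<open>From the pointwise identity to the harmonic coefficients\<close>

theorem theorem3:
  fixes n :: nat
    and f F :: "(real ^ 'm) \<times> (real ^ 'm) \<Rightarrow> complex"
    and Y :: "nat \<Rightarrow> nat \<Rightarrow> real ^ 'm \<Rightarrow> complex"
  assumes "n \<ge> 3"
    and "CARD('m) = n - 1"
    and "schwartz_radial f"
    and "F = cone_transform f"
    and "harmonic_basis Y"
  shows "\<forall>l. \<forall>k\<in>{1..num_harmonics (n - 1) l}. \<forall>\<rho>>0. \<forall>y.
    harmonic_coeff Y (fourier_fst f) k l \<rho> y =
    of_real (\<rho> ^ (n - 1) / (2 * pi) ^ (n - 1)) *
      harmonic_coeff Y (fourier_both F) k l \<rho> (\<rho> *\<^sub>R y)"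
proof (intro allI ballI impI)
  fix l k and \<rho> :: real and y :: "real ^ 'm"
  assume \<rho>: "\<rho> > 0"
  let ?c = "complex_of_real (\<rho> ^ (n - 1) / (2 * pi) ^ (n - 1))"
  have "harmonic_coeff Y (fourier_fst f) k l \<rho> y =
      (\<integral>\<phi>. ?c * (fourier_both F (\<rho> *\<^sub>R \<phi>, \<rho> *\<^sub>R y) * cnj (Y l k \<phi>)) \<partial>sphere_measure)"
    unfolding harmonic_coeff_def sphere_inner_def
  proof (rule Bochner_Integration.integral_cong[OF refl])
    \<comment> \<open>On the unit sphere \<open>\<rho> *\<^sub>R \<phi>\<close> has norm
      \<open>\<rho>\<close>, so the factor of the pointwise identity is constant in
      \<open>\<phi>\<close> and can leave the integral.\<close>
    fix \<phi> :: "real ^ 'm" assume "\<phi> \<in> space sphere_measure"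
    then have "norm \<phi> = 1" by (simp add: sphere_measure_def space_restrict_space)
    then have "\<rho> *\<^sub>R \<phi> \<noteq> 0" "norm (\<rho> *\<^sub>R \<phi>) = \<rho>" using \<rho> by auto
    then show "fourier_fst f (\<rho> *\<^sub>R \<phi>, y) * cnj (Y l k \<phi>) =
        ?c * (fourier_both F (\<rho> *\<^sub>R \<phi>, \<rho> *\<^sub>R y) * cnj (Y l k \<phi>))"
      using fourier_slice_cone_transform[OF assms(3), of "\<rho> *\<^sub>R \<phi>" y] assms(2,4) by simp
  qed
  then show "harmonic_coeff Y (fourier_fst f) k l \<rho> y =
      ?c * harmonic_coeff Y (fourier_both F) k l \<rho> (\<rho> *\<^sub>R y)"
    unfolding harmonic_coeff_def sphere_inner_def by simp
qed

end
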